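(* The spectrum of the Casimirs $\mathbf C_k$ ($k=1,\dots,n$) of $\mathcal U_q^{sc}(\mathfrak{sl}_{n+1})$ acting on the minimal positive representations $\mathcal P^J_\lambda$ ($\lambda\in\mathbb R$) of $\mathcal U_q(\mathfrak{sl}(n+1,\mathbb R))$ is real-valued, and lies outside the positive spectrum of the positive Casimirs of the maximal positive representations.
   Context: $q=e^{\pi\sqrt{-1}b^2}$, $0<b<1$; $(a_{ij})$ is the Cartan matrix of type $A_n$. $\mathcal U_q(\mathfrak{sl}_{n+1})$ is generated by $\mathbf e_i,\mathbf f_i,\mathbf K_i^{\pm1}$ ($1\le i\le n$) with $\mathbf K_i\mathbf K_j=\mathbf K_j\mathbf K_i$, $\mathbf K_i\mathbf e_j=q^{a_{ij}}\mathbf e_j\mathbf K_i$, $\mathbf K_i\mathbf f_j=q^{-a_{ij}}\mathbf f_j\mathbf K_i$, $[\mathbf e_i,\mathbf f_j]=\delta_{ij}(q-q^{-1})(\mathbf K_i^{-1}-\mathbf K_i)$ and the quantum Serre relations; $\mathcal U_q(\mathfrak{sl}(n+1,\mathbb R))$ is the real form in which the generators $\mathbf e_i,\mathbf f_i,\mathbf K_i$ are self-adjoint. $\mathcal U_q^{sc}(\mathfrak{sl}_{n+1})$ is obtained by adjoining $\mathbf K_i^{\pm1/(n+1)}$, to which positive representations extend naturally. Minimal positive representation $\mathcal P_\lambda^J$, $J=\{1,\dots,n-1\}$: on $L^2(\mathbb R^n,du_1\cdots du_n)$ with $p_k=\frac1{2\pi\sqrt{-1}}\partial_{u_k}$, $e(L):=e^{\pi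 bL}$, $[L_1]e(L_2):=e(L_1+L_2)+e(-L_1+L_2)$, $\mathbf e_1\mapsto[u_1]e(-2p_1)$, $\mathbf e_i\mapsto[u_i-u_{i-1}]e(-2p_i)$ for $i\ge2$, $\mathbf f_i\mapsto[-u_i+u_{i+1}]e(2p_i)$ for $i<n$, $\mathbf f_n\mapsto[2\lambda-u_n]e(2p_n)$, $\mathbf K_i\mapsto e(-\sum_ja_{ij}u_j)$ for $i<n$, $\mathbf K_n\mapsto e(-\sum_ja_{nj}u_j+2\lambda)$. It is irreducible, so central elements act by scalars. Casimirs: $\mathbf C_1,\dots,\mathbf C_n$ generate the center of $\mathcal U_q^{sc}(\mathfrak{sl}_{n+1})$, and $$\mathbf C_k=(-1)^{n}\sum_{\nu}q^{\sum_iW_{\nu,i}}\prod_{i=1}^n\mathbf K_i^{W_{\nu,i}}+\mathbf C_E,$$ where $\nu$ runs over the $\binom{n+1}{k}$ weights of the $k$-th fundamental representation, $2\nu=\sum_iW_{\nu,i}\alpha_i$ with $\alpha_i$ the simple roots, and $\mathbf C_E$ consists of terms with some $\mathbf e_i$ acting on the right. For example, for $n=2$ and $\mathbf K=\mathbf K_1^{1/3}\mathbf K_2^{-1/3}$, $\mathbf C_1=\mathbf K(q^2\mathbf K_1\mathbf K_2+\mathbf K_1^{-1}\mathbf K_2+q^{-2}\mathbf K_1^{-1}\mathbf K_2^{-1})+\mathbf C_E$. Spectrum of the positive Casimirs: in the maximal positive representations (the positive representations of $\mathcal U_q(\mathfrak{sl}(n+1,\mathbb R))$ on $L^2(\mathbb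 R^{n(n+1)/2})$ associated with the Borel subgroup), the values of $(\mathbf C_1,\dots,\mathbf C_n)$ are positive and lie in a connected region of the positive orthant of $\mathbb R^n$ bounded by the discriminant variety, i.e. by the discriminant of the polynomial $P(x)=x^{n+1}+C_1x^n+\dots+C_nx+1$, which there factors as $\prod_i(x+e^{L_i})$ with $C_1=\sum_ie^{L_i}$, $L_i\in\mathbb R$.
   Formalization: The claim is proved for n ≥ 2; for n = 1 the set J is empty, the minimal representation is the maximal one, and C_1 acts by e^{2πbλ}+e^{-2πbλ}, which lies in the positive spectrum. *)

theory Defs
  imports "HOL-Analysis.Analysis" "HOL-Library.Poly_Mapping"
begin

section \<open>Free associative algebras\<close>

datatype 'g free_monoid = Word (letters: "'g list")

instantiation free_monoid :: (type) monoid_add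
begin
definition "0 = Word []"
definition "v + w = Word (letters v @ letters w)"
instance by standard (simp_all add: zero_free_monoid_def plus_free_monoid_def)
end

text \<open>Finitely supported functions on words with convolution as multiplication
  (the ring structure provided by \<open>Poly_Mapping\<close>) form the free unital
  associative complex algebra on \<open>'g\<close>.\<close>

type_synonym 'g free_algebra = "'g free_monoid \<Rightarrow>\<^sub>0 complex"

definition scal :: "complex \<Rightarrow> 'g free_algebra" where
  "scal c = Poly_Mapping.single 0 c"

definition gen :: "'g \<Rightarrow> 'g free_algebra" where
  "gen g = Poly_Mapping.single (Word [g]) 1"


section \<open>The quantum group\<close>

definition cartan :: "nat \<Rightarrow> nat \<Rightarrow> int" where
  "cartan i j = (if i = j then 2 else if i = Suc j \<or> j = Suc i then -1 else 0)"

text \<open>\<open>qpow b x\<close> is \<open>q\<^sup>x\<close> for real \<open>x\<close>, where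
  \<open>q = exp (\<pi> \<i> b\<^sup>2)\<close>.\<close>

definition qpow :: "real \<Rightarrow> real \<Rightarrow> complex" where
  "qpow b x = exp (\<i> * of_real (pi * b\<^sup>2 * x))"

text \<open>\<open>Kr i\<close> and \<open>Kr_inv i\<close> stand for the adjoined roots of
  \<open>K\<^sub>i\<close> and its inverse with exponent \<open>1 / (n+1)\<close>.\<close>

datatype uq_gen = Eg nat | Fg nat | Kr nat | Kr_inv nat

type_synonym uq_free = "uq_gen free_algebra"

abbreviation ue :: "nat \<Rightarrow> uq_free" where "ue i \<equiv> gen (Eg i)"
abbreviation uf :: "nat \<Rightarrow> uq_free" where "uf i \<equiv> gen (Fg i)"

definition Kroot_power :: "nat \<Rightarrow> int \<Rightarrow> uq_free" where
  "Kroot_power i m = (if 0 \<le> m then gen (Kr i) ^ nat m else gen (Kr_inv i) ^ nat (- m))"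

abbreviation uK :: "nat \<Rightarrow> nat \<Rightarrow> uq_free" where
  "uK n i \<equiv> Kroot_power i (int (n + 1))"
abbreviation uK_inv :: "nat \<Rightarrow> nat \<Rightarrow> uq_free" where
  "uK_inv n i \<equiv> Kroot_power i (- int (n + 1))"

text \<open>The defining relators. As the generators are indexed by all natural numbers,
  those with an index outside \<open>{1..n}\<close> are put to zero.\<close>

inductive_set uq_relators :: "nat \<Rightarrow> real \<Rightarrow> uq_free set"
  for n :: nat and b :: real where
  outside: "i \<notin> {1..n} \<Longrightarrow> g \<in> {Eg i, Fg i, Kr i, Kr_inv i} \<Longrightarrow> gen g \<in> uq_relators n b"
| K_left: "i \<in> {1..n} \<Longrightarrow> gen (Kr_inv i) * gen (Kr i) - 1 \<in> uq_relators n b"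
| K_right: "i \<in> {1..n} \<Longrightarrow> gen (Kr i) * gen (Kr_inv i) - 1 \<in> uq_relators n b"
| KK: "i \<in> {1..n} \<Longrightarrow> j \<in> {1..n} \<Longrightarrow>
    gen (Kr i) * gen (Kr j) - gen (Kr j) * gen (Kr i) \<in> uq_relators n b"
| Ke: "i \<in> {1..n} \<Longrightarrow> j \<in> {1..n} \<Longrightarrow>
    gen (Kr i) * ue j - scal (qpow b (cartan i j / (n + 1))) * ue j * gen (Kr i) \<in> uq_relators n b"
| Kf: "i \<in> {1..n} \<Longrightarrow> j \<in> {1..n} \<Longrightarrow>
    gen (Kr i) * uf j - scal (qpow b (- cartan i j / (n + 1))) * uf j * gen (Kr i) \<in> uq_relators n b"
| ef: "i \<in> {1..n} \<Longrightarrow> j \<in> {1..n} \<Longrightarrow>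
    ue i * uf j - uf j * ue i
      - (if i = j then scal (qpow b 1 - qpow b (-1)) * (uK_inv n i - uK n i) else 0)
      \<in> uq_relators n b"
| ee: "i \<in> {1..n} \<Longrightarrow> j \<in> {1..n} \<Longrightarrow> cartan i j = 0 \<Longrightarrow>
    ue i * ue j - ue j * ue i \<in> uq_relators n b"
| ff: "i \<in> {1..n} \<Longrightarrow> j \<in> {1..n} \<Longrightarrow> cartan i j = 0 \<Longrightarrow>
    uf i * uf j - uf j * uf i \<in> uq_relators n b"
| serre_e: "i \<in> {1..n} \<Longrightarrow> j \<in> {1..n} \<Longrightarrow> cartan i j = -1 \<Longrightarrow>
    ue i * ue i * ue j - scal (qpow b 1 + qpow b (-1)) * ue i * ue j * ue i + ue j * ue i * ue i
      \<in> uq_relators n b"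
| serre_f: "i \<in> {1..n} \<Longrightarrow> j \<in> {1..n} \<Longrightarrow> cartan i j = -1 \<Longrightarrow>
    uf i * uf i * uf j - scal (qpow b 1 + qpow b (-1)) * uf i * uf j * uf i + uf j * uf i * uf i
      \<in> uq_relators n b"

text \<open>The simply connected quantum group is the quotient of the free algebra by the
  two-sided ideal \<open>uq_ideal n b\<close>. Its elements are handled through representatives
  in the free algebra; the subsets of the quotient defined below are given by their full preimages.\<close>

inductive_set uq_ideal :: "nat \<Rightarrow> real \<Rightarrow> uq_free set"
  for n :: nat and b :: real where
  zero: "0 \<in> uq_ideal n b"
| relator: "r \<in> uq_relators n b \<Longrightarrow> x * r * y \<in> uq_ideal n b"
| add: "x \<in> uq_ideal n b \<Longrightarrow> y \<in> uq_ideal n b \<Longrightarrow> x + y \<in> uq_ideal n b"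

definition uq_center :: "nat \<Rightarrow> real \<Rightarrow> uq_free set" where
  "uq_center n b = {z. \<forall>x. x * z - z * x \<in> uq_ideal n b}"

inductive_set uq_subalgebra :: "nat \<Rightarrow> real \<Rightarrow> uq_free set \<Rightarrow> uq_free set"
  for n :: nat and b :: real and X :: "uq_free set" where
  const: "scal c \<in> uq_subalgebra n b X"
| base: "x \<in> X \<Longrightarrow> x \<in> uq_subalgebra n b X"
| add: "x \<in> uq_subalgebra n b X \<Longrightarrow> y \<in> uq_subalgebra n b X \<Longrightarrow> x + y \<in> uq_subalgebra n b X"
| mult: "x \<in> uq_subalgebra n b X \<Longrightarrow> y \<in> uq_subalgebra n b X \<Longrightarrow> x * y \<in> uq_subalgebra n b X"
| cong: "x \<in> uq_subalgebra n b X \<Longrightarrow> y - x \<in> uq_ideal n b \<Longrightarrow> y \<in> uq_subalgebra n b X"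

text \<open>Sums of terms in which some \<open>e\<^sub>i\<close> is the rightmost factor, i.e. acts first.\<close>

definition e_left_ideal :: "nat \<Rightarrow> real \<Rightarrow> uq_free set" where
  "e_left_ideal n b = {y. \<exists>x. y - (\<Sum>i\<in>{1..n}. x i * ue i) \<in> uq_ideal n b}"


section \<open>Casimir elements\<close>

text \<open>The weights of the \<open>k\<close>-th fundamental representation (the \<open>k\<close>-th exterior
  power of the vector representation) are the sums over \<open>j \<in> S\<close> of the weights
  \<open>\<epsilon>\<^sub>j\<close> of the vector representation, where \<open>S\<close> is a subset of
  \<open>{1..n+1}\<close> of size \<open>k\<close>. Vectors in the weight space are written in the coordinates of
  \<open>\<real>\<^sup>n\<^sup>+\<^sup>1\<close> in which \<open>\<alpha>\<^sub>i\<close> is the \<open>i\<close>-th minus the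
  \<open>(i+1)\<close>-st unit vector and all weights have coordinate sum zero.\<close>

definition fund_index :: "nat \<Rightarrow> nat \<Rightarrow> nat set set" where
  "fund_index n k = {S. S \<subseteq> {1..n+1} \<and> card S = k}"

definition fund_weight :: "nat \<Rightarrow> nat set \<Rightarrow> nat \<Rightarrow> real" where
  "fund_weight n S j = (if j \<in> S then 1 else 0) - card S / (n + 1)"

definition simple_root :: "nat \<Rightarrow> nat \<Rightarrow> real" where
  "simple_root i j = (if j = i then 1 else if j = Suc i then -1 else 0)"

text \<open>\<open>weight_coeff_scaled n S i\<close> is \<open>n + 1\<close> times the coefficient \<open>weight_coeff n S i\<close> of
  \<open>\<alpha>\<^sub>i\<close> in twice the weight; it is the exponent of the \<open>(n+1)\<close>-st root of
  \<open>K\<^sub>i\<close>.\<close>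

definition weight_coeff_scaled :: "nat \<Rightarrow> nat set \<Rightarrow> nat \<Rightarrow> int" where
  "weight_coeff_scaled n S i = 2 * (int (n + 1) * int (card (S \<inter> {1..i})) - int i * int (card S))"

definition weight_coeff :: "nat \<Rightarrow> nat set \<Rightarrow> nat \<Rightarrow> real" where
  "weight_coeff n S i = weight_coeff_scaled n S i / (n + 1)"

lemma twice_fund_weight:
  assumes "S \<subseteq> {1..n+1}" "j \<in> {1..n+1}"
  shows "2 * fund_weight n S j = (\<Sum>i\<in>{1..n}. weight_coeff n S i * simple_root i j)"
proof -
  let ?w = "weight_coeff n S"
  obtain m where m: "j = Suc m" "m \<le> n"
    using assms(2) by (cases j) auto
  have w0: "?w 0 = 0"
    by (simp add: weight_coeff_def weight_coeff_scaled_def)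
  have "S \<inter> {1..n+1} = S"
    using assms(1) by blast
  then have wn: "?w (Suc n) = 0"
    by (simp add: weight_coeff_def weight_coeff_scaled_def)
  have "(\<Sum>i\<in>{1..n}. ?w i * simple_root i j)
      = (\<Sum>i\<in>{1..n}. (if i = j then ?w i else 0) - (if i = m then ?w i else 0))"
    by (rule sum.cong) (auto simp: simple_root_def m)
  also have "\<dots> = (if j \<le> n then ?w j else 0) - (if 1 \<le> m then ?w m else 0)"
    using m by (simp add: sum_subtractf)
  also have "\<dots> = ?w (Suc m) - ?w m"
  proof -
    have "(if j \<le> n then ?w j else 0) = ?w (Suc m)"
      using m wn by (cases "m = n") auto
    moreover have "(if 1 \<le> m then ?w m else 0) = ?w m"
      using w0 by (cases m) auto
    ultimately show ?thesis by simp
  qed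
  finally have *: "(\<Sum>i\<in>{1..n}. ?w i * simple_root i j) = ?w (Suc m) - ?w m" .
  have "S \<inter> {1..Suc m} = (if j \<in> S then insert (Suc m) (S \<inter> {1..m}) else S \<inter> {1..m})"
    by (auto simp: m le_Suc_eq)
  then have card: "real (card (S \<inter> {1..Suc m})) = real (card (S \<inter> {1..m})) + (if j \<in> S then 1 else 0)"
    by simp
  have w: "?w i = 2 * real (card (S \<inter> {1..i})) - 2 * real i * (real (card S) / real (n + 1))" for i
    by (simp add: weight_coeff_def weight_coeff_scaled_def divide_simps) (simp add: algebra_simps)
  show ?thesis
    unfolding * unfolding w card fund_weight_def by (simp add: algebra_simps)
qed

definition casimir_leading :: "nat \<Rightarrow> real \<Rightarrow> nat \<Rightarrow> uq_free" where
  "casimir_leading n b k = scal ((-1) ^ n) *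
     (\<Sum>S\<in>fund_index n k. scal (qpow b (\<Sum>i\<in>{1..n}. weight_coeff n S i)) *
        prod_list (map (\<lambda>i. Kroot_power i (weight_coeff_scaled n S i)) [1..<n+1]))"

definition casimirs :: "nat \<Rightarrow> real \<Rightarrow> (nat \<Rightarrow> uq_free) \<Rightarrow> bool" where
  "casimirs n b C \<longleftrightarrow>
     uq_subalgebra n b (C ` {1..n}) = uq_center n b \<and>
     (\<forall>k\<in>{1..n}. C k - casimir_leading n b k \<in> e_left_ideal n b)"


section \<open>Minimal positive representations\<close>

text \<open>Points of \<open>\<complex>\<^sup>n\<close> are functions on \<open>nat\<close> of which only the values on
  \<open>{1..n}\<close> matter. All operators act on the following dense subspace of
  \<open>L\<^sup>2(\<real>\<^sup>n)\<close>, which is a common invariant domain of all \<open>e(L)\<close>: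
  entire functions (holomorphic in each variable) all of whose translates in imaginary directions,
  multiplied by arbitrary real exponentials, are square integrable over \<open>\<real>\<^sup>n\<close>.
  It contains all products of a Gaussian with a polynomial. An element of \<open>L\<^sup>2\<close> determines its
  entire extension.\<close>

type_synonym cfun = "(nat \<Rightarrow> complex) \<Rightarrow> complex"

definition rep_core :: "nat \<Rightarrow> cfun set" where
  "rep_core n = {\<phi>.
     (\<forall>z z'. (\<forall>i\<in>{1..n}. z i = z' i) \<longrightarrow> \<phi> z = \<phi> z') \<and>
     (\<forall>i\<in>{1..n}. \<forall>z. (\<lambda>t. \<phi> (z(i := t))) holomorphic_on UNIV) \<and>
     (\<forall>a v :: nat \<Rightarrow> real. integrable (Pi\<^sub>M {1..n} (\<lambda>_. lborel))
        (\<lambda>u. (exp (\<Sum>k\<in>{1..n}. a k * u k) *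
               norm (\<phi> (\<lambda>k. complex_of_real (u k) + \<i> * of_real (v k))))\<^sup>2))}"

text \<open>\<open>weyl n b a c d\<close> is \<open>e(L) = exp (\<pi> b L)\<close> for
  \<open>L = (\<Sum>k. a\<^sub>k u\<^sub>k + c\<^sub>k p\<^sub>k) + d\<close>. With
  \<open>p\<^sub>k = (2 \<pi> \<i>)\<^sup>-\<^sup>1 \<partial>/\<partial>u\<^sub>k\<close>, the operator
  \<open>exp (\<pi> b c p\<^sub>k)\<close> translates \<open>u\<^sub>k\<close> by \<open>- \<i> b c / 2\<close>, and the
  Baker-Campbell-Hausdorff formula with \<open>[u\<^sub>k, p\<^sub>k] = \<i> / (2 \<pi>)\<close> gives the factor
  \<open>exp (- \<i> \<pi> b\<^sup>2 a\<^sub>k c\<^sub>k / 4)\<close> when the translation is moved to the right.\<close>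

definition weyl ::
  "nat \<Rightarrow> real \<Rightarrow> (nat \<Rightarrow> real) \<Rightarrow> (nat \<Rightarrow> real) \<Rightarrow> real \<Rightarrow> cfun \<Rightarrow> cfun" where
  "weyl n b a c d \<phi> = (\<lambda>z.
     exp (of_real (pi * b) * ((\<Sum>k\<in>{1..n}. of_real (a k) * z k) + of_real d)
          - \<i> * of_real (pi * b\<^sup>2 / 4 * (\<Sum>k\<in>{1..n}. a k * c k))) *
     \<phi> (\<lambda>k. z k - \<i> * of_real (b * c k / 2)))"

text \<open>\<open>bracket n b a d c\<close> is \<open>[L\<^sub>1] e(L\<^sub>2)\<close> for
  \<open>L\<^sub>1 = (\<Sum>k. a\<^sub>k u\<^sub>k) + d\<close> and
  \<open>L\<^sub>2 = (\<Sum>k. c\<^sub>k p\<^sub>k)\<close>.\<close>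

definition bracket ::
  "nat \<Rightarrow> real \<Rightarrow> (nat \<Rightarrow> real) \<Rightarrow> real \<Rightarrow> (nat \<Rightarrow> real) \<Rightarrow> cfun \<Rightarrow> cfun" where
  "bracket n b a d c \<phi> =
     (\<lambda>z. weyl n b a c d \<phi> z + weyl n b (\<lambda>k. - a k) c (- d) \<phi> z)"

definition delta :: "nat \<Rightarrow> nat \<Rightarrow> real" where
  "delta i k = (if k = i then 1 else 0)"

primrec gen_op :: "nat \<Rightarrow> real \<Rightarrow> real \<Rightarrow> uq_gen \<Rightarrow> cfun \<Rightarrow> cfun" where
  "gen_op n b l (Eg i) =
     (if i \<notin> {1..n} then (\<lambda>\<phi> z. 0)
      else if i = 1 then bracket n b (delta 1) 0 (\<lambda>k. - 2 * delta 1 k)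
      else bracket n b (\<lambda>k. delta i k - delta (i - 1) k) 0 (\<lambda>k. - 2 * delta i k))"
| "gen_op n b l (Fg i) =
     (if i \<notin> {1..n} then (\<lambda>\<phi> z. 0)
      else if i < n then bracket n b (\<lambda>k. - delta i k + delta (i + 1) k) 0 (\<lambda>k. 2 * delta i k)
      else bracket n b (\<lambda>k. - delta n k) (2 * l) (\<lambda>k. 2 * delta n k))"
| "gen_op n b l (Kr i) =
     (if i \<notin> {1..n} then (\<lambda>\<phi> z. 0)
      else weyl n b (\<lambda>j. - cartan i j / (n + 1)) (\<lambda>_. 0) ((if i < n then 0 else 2 * l) / (n + 1)))"
| "gen_op n b l (Kr_inv i) =
     (if i \<notin> {1..n} then (\<lambda>\<phi> z. 0)
      else weyl n b (\<lambda>j. cartan i j / (n + 1)) (\<lambda>_. 0) (- (if i < n then 0 else 2 * l) / (n + 1)))"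

text \<open>The leftmost letter of a word acts last. The action factors through the quotient by
  \<open>uq_ideal n b\<close>.\<close>

definition minimal_rep :: "nat \<Rightarrow> real \<Rightarrow> real \<Rightarrow> uq_free \<Rightarrow> cfun \<Rightarrow> cfun" where
  "minimal_rep n b l x \<phi> = (\<lambda>z. \<Sum>w\<in>Poly_Mapping.keys x.
     Poly_Mapping.lookup x w * foldr (gen_op n b l) (letters w) \<phi> z)"


section \<open>The positive spectrum\<close>

text \<open>The closed region of the positive orthant bounded by the discriminant of
  \<open>x\<^sup>n\<^sup>+\<^sup>1 + c\<^sub>1 x\<^sup>n + \<dots> + c\<^sub>n x + 1\<close> which contains the joint
  spectrum of the positive Casimirs in the maximal positive representations.\<close>

definition positive_casimir_region :: "nat \<Rightarrow> (nat \<Rightarrow> real) set" where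
  "positive_casimir_region n = {c.
     (\<forall>k\<in>{1..n}. 0 < c k) \<and>
     (\<exists>L :: nat \<Rightarrow> real.
        monom 1 (n + 1) + (\<Sum>k\<in>{1..n}. monom (c k) (n + 1 - k)) + 1
          = (\<Prod>i\<in>{0..n}. [:exp (L i), 1:]))}"

text \<open>The sign \<open>(-1)\<^sup>n\<close> in \<open>casimir_leading\<close> does not depend on \<open>k\<close>,
  while on a maximal positive representation the sum over the weights has the sign \<open>(-1)\<^sup>n\<^sup>k\<close>.
  So for odd \<open>n\<close> and even \<open>k\<close> it is \<open>- C k\<close> that is positive there.
  The following passes from the values of the \<open>C k\<close> to those of the Casimirs with the sign
  \<open>(-1)\<^sup>n\<^sup>k\<close>.\<close>

definition positive_normalization :: "nat \<Rightarrow> (nat \<Rightarrow> real) \<Rightarrow> nat \<Rightarrow> real" where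
  "positive_normalization n c k = (-1) ^ (n * (k + 1)) * c k"

end

(* The operators e(L) make sense on arbitrary functions of n complex variables, and the quantum group
   acts there by difference operators. On this larger space there is a highest weight vector: the
   indicator function of a point at which the coefficients of all e_i vanish. Its weight gives the
   value of the Casimirs, (-1)^n times the elementary symmetric functions of the n + 1 numbers
   - t q^(n-1), - t q^(n-3), ..., - t q^(1-n) and (-1)^n t^(-n), where t = exp (4 pi b l / (n + 1)).

   If q is not a root of unity, a difference operator commuting with the K_i is a multiplication
   operator, and one commuting with the e_i as well is constant, so central elements act by scalars
   and the value above is the spectrum. If q is a root of unity, no elements C_k as required exist:
   the center contains a power of a root of K_1, which is not a polynomial in the C_k.

   In the normalization with signs (-1)^(nk), the quotient q^2 of the first two roots of the
   polynomial is not positive; for odd n and the other normalization the position is excluded by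
   inequalities between the values of C_1, C_2, C_(n-1) and C_n. *)

theory Submission
  imports Defs
begin

section \<open>Actions of free algebras on function spaces\<close>

text \<open>\<open>casimirs\<close> describes \<open>C k\<close> explicitly only up to terms ending
  in some \<open>ue i\<close>, so its value can be read off only from a vector annihilated by all
  \<open>e\<close>. Within \<open>rep_core\<close> there is none: in L^2 the \<open>e\<close> are
  positive with trivial kernel. As translations of complex points they have coefficients r + 1/r,
  and these vanish at r = i. The coordinates of \<open>top_point\<close> grow in steps of i (b +
  1/b)/2: the part 1/b produces the factor i and, at the last node, the minus sign in front of t.
  The value found there says something about \<open>rep_core\<close> only if a single scalar
  describes the action on all functions. At a root of unity a power of \<open>Kr 1\<close> is
  central and acts by a nonconstant function, so genericity of q has to be extracted from
  \<open>casimirs\<close> itself. This is why a second module is needed, one that agrees with the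
  first on every \<open>C k\<close> at a highest weight vector but differs from it on
  \<open>Kr 1\<close>.\<close>

definition lin_op :: "(('a \<Rightarrow> complex) \<Rightarrow> 'a \<Rightarrow> complex) \<Rightarrow> bool" where
  "lin_op A \<longleftrightarrow> (\<forall>\<phi> \<psi>. A (\<lambda>z. \<phi> z + \<psi> z) = (\<lambda>z. A \<phi> z + A \<psi> z)) \<and>
    (\<forall>c \<phi>. A (\<lambda>z. c * \<phi> z) = (\<lambda>z. c * A \<phi> z))"

text \<open>\<open>minimal_rep\<close> with the generator action as a parameter, so that the twisted
  action of \<open>uq_module_dual\<close> is covered by the same lemmas.\<close>

definition rep :: "('g \<Rightarrow> ('a \<Rightarrow> complex) \<Rightarrow> 'a \<Rightarrow> complex) \<Rightarrow> 'g free_algebra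
    \<Rightarrow> ('a \<Rightarrow> complex) \<Rightarrow> 'a \<Rightarrow> complex" where
  "rep G x \<phi> = (\<lambda>z. \<Sum>w\<in>Poly_Mapping.keys x.
     Poly_Mapping.lookup x w * foldr G (letters w) \<phi> z)"

lemma minimal_rep_eq: "minimal_rep n b l = rep (gen_op n b l)"
  by (intro ext) (simp add: minimal_rep_def rep_def)

lemma lin_op_add: "lin_op A \<Longrightarrow> A (\<lambda>z. \<phi> z + \<psi> z) = (\<lambda>z. A \<phi> z + A \<psi> z)"
  and lin_op_scale: "lin_op A \<Longrightarrow> A (\<lambda>z. c * \<phi> z) = (\<lambda>z. c * A \<phi> z)"
  by (auto simp: lin_op_def)

lemma lin_op_zero: "lin_op A \<Longrightarrow> A (\<lambda>z. 0) = (\<lambda>z. 0)"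
  using lin_op_scale[of A 0 "\<lambda>z. 0"] by simp

lemma lin_op_foldr: "(\<And>g. lin_op (G g)) \<Longrightarrow> lin_op (foldr G ws)"
  by (induction ws) (simp_all add: lin_op_def)

lemma lin_op_rep:
  assumes "\<And>g. lin_op (G g)"
  shows "lin_op (rep G x)"
  using lin_op_foldr[of G, OF assms]
  by (simp add: lin_op_def rep_def sum.distrib sum_distrib_left algebra_simps)

lemma rep_superset:
  assumes "finite W" "Poly_Mapping.keys x \<subseteq> W"
  shows "rep G x \<phi> z = (\<Sum>w\<in>W. Poly_Mapping.lookup x w * foldr G (letters w) \<phi> z)"
  unfolding rep_def using assms
  by (intro sum.mono_neutral_left) (auto simp: in_keys_iff)

lemma rep_add: "rep G (x + y) \<phi> = (\<lambda>z. rep G x \<phi> z + rep G y \<phi> z)"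
proof
  fix z
  let ?W = "Poly_Mapping.keys x \<union> Poly_Mapping.keys y"
  have "Poly_Mapping.keys (x + y) \<subseteq> ?W"
    by (rule Poly_Mapping.keys_add)
  then show "rep G (x + y) \<phi> z = rep G x \<phi> z + rep G y \<phi> z"
    by (simp add: rep_superset[of ?W] lookup_add algebra_simps sum.distrib)
qed

lemma rep_zero: "rep G 0 \<phi> = (\<lambda>z. 0)"
  by (simp add: rep_def)

lemma rep_minus: "rep G (x - y) \<phi> = (\<lambda>z. rep G x \<phi> z - rep G y \<phi> z)"
proof
  fix z
  show "rep G (x - y) \<phi> z = rep G x \<phi> z - rep G y \<phi> z"
    using fun_cong[OF rep_add[of G "x - y" y \<phi>], of z] by (simp add: algebra_simps)
qed

lemma rep_sum: "rep G (\<Sum>i\<in>I. x i) \<phi> = (\<lambda>z. \<Sum>i\<in>I. rep G (x i) \<phi> z)"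
  by (induction I rule: infinite_finite_induct) (simp_all add: rep_zero rep_add)

lemma rep_single:
  "rep G (Poly_Mapping.single w c) \<phi> = (\<lambda>z. c * foldr G (letters w) \<phi> z)"
  by (auto simp: rep_def)

lemma rep_scal: "rep G (scal c) \<phi> = (\<lambda>z. c * \<phi> z)"
  by (simp add: scal_def rep_single zero_free_monoid_def)

lemma rep_gen: "rep G (gen g) \<phi> = G g \<phi>"
  by (simp add: gen_def rep_single)

lemma rep_one: "rep G 1 \<phi> = \<phi>"
  using rep_scal[of G 1 \<phi>] by (simp add: scal_def flip: single_one)

lemma free_algebra_induct [case_names single add]:
  fixes x :: "'g free_algebra"
  assumes single: "\<And>w c. P (Poly_Mapping.single w c)"
    and add: "\<And>x y. P x \<Longrightarrow> P y \<Longrightarrow> P (x + y)"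
  shows "P x"
proof (induction x rule: update_induct)
  case const
  show ?case using single[of _ 0] by simp
next
  case (update f a b)
  have "Poly_Mapping.update a b f = f + Poly_Mapping.single a b"
    using update(1) by (intro poly_mapping_eqI)
      (auto simp: lookup_update lookup_add lookup_single when_def in_keys_iff)
  then show ?case using add[OF update(3) single] by simp
qed

text \<open>The coefficients of \<open>y\<close> have to pass through the letters of
  \<open>x\<close>, which linearity of the generators permits.\<close>

lemma rep_mult:
  assumes lin: "\<And>g. lin_op (G g)"
  shows "rep G (x * y) \<phi> = rep G x (rep G y \<phi>)"
proof -
  have monomials: "rep G (Poly_Mapping.single v c * Poly_Mapping.single w d) \<phi>
      = rep G (Poly_Mapping.single v c) (rep G (Poly_Mapping.single w d) \<phi>)" for v w c d
    by (simp add: mult_single rep_single plus_free_monoid_def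
        lin_op_scale[OF lin_op_foldr[of G "letters v", OF lin]] mult_ac)
  have right: "rep G (Poly_Mapping.single v c * y) \<phi>
      = rep G (Poly_Mapping.single v c) (rep G y \<phi>)" for v c
  proof (induction y rule: free_algebra_induct)
    case (single w d)
    then show ?case by (rule monomials)
  next
    case (add x y)
    then show ?case
      by (simp add: distrib_left rep_add lin_op_add[OF lin_op_rep[of G, OF lin]])
  qed
  show ?thesis
  proof (induction x rule: free_algebra_induct)
    case (single w c)
    then show ?case by (rule right)
  next
    case (add x y)
    then show ?case by (simp add: distrib_right rep_add)
  qed
qed

lemma rep_power:
  assumes "\<And>g. lin_op (G g)"
  shows "rep G (x ^ m) \<phi> = (rep G x ^^ m) \<phi>"
  by (induction m) (simp_all add: rep_one rep_mult[of G, OF assms])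

lemma rep_power_eigen:
  assumes "\<And>g. lin_op (G g)" and "rep G x \<phi> = (\<lambda>z. c * \<phi> z)"
  shows "rep G (x ^ m) \<phi> = (\<lambda>z. c ^ m * \<phi> z)"
proof (induction m)
  case (Suc m)
  have "rep G (x ^ Suc m) \<phi> = rep G x (\<lambda>z. c ^ m * \<phi> z)"
    by (simp add: rep_mult[of G, OF assms(1)] Suc)
  also have "\<dots> = (\<lambda>z. c ^ m * rep G x \<phi> z)"
    by (rule lin_op_scale[OF lin_op_rep[of G, OF assms(1)]])
  finally show ?case by (simp add: assms(2) mult_ac)
qed (simp add: rep_one)

lemma rep_prod_list_eigen:
  assumes "\<And>g. lin_op (G g)" and "\<And>x. x \<in> set xs \<Longrightarrow> rep G (f x) \<phi> = (\<lambda>z. c x * \<phi> z)"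
  shows "rep G (prod_list (map f xs)) \<phi> = (\<lambda>z. prod_list (map c xs) * \<phi> z)"
  using assms(2)
proof (induction xs)
  case (Cons x xs)
  have "rep G (prod_list (map f (x # xs))) \<phi> = rep G (f x) (\<lambda>z. prod_list (map c xs) * \<phi> z)"
    using Cons by (simp add: rep_mult[of G, OF assms(1)])
  also have "\<dots> = (\<lambda>z. prod_list (map c xs) * rep G (f x) \<phi> z)"
    by (rule lin_op_scale[OF lin_op_rep[of G, OF assms(1)]])
  finally show ?case by (simp add: Cons.prems mult_ac)
qed (simp add: rep_one)

section \<open>Modules and highest weight vectors\<close>

definition uq_module :: "nat \<Rightarrow> real \<Rightarrow> (uq_gen \<Rightarrow> ('a \<Rightarrow> complex) \<Rightarrow> 'a \<Rightarrow> complex) \<Rightarrow> bool" where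
  "uq_module n b G \<longleftrightarrow> (\<forall>g. lin_op (G g)) \<and>
     (\<forall>r\<in>uq_relators n b. \<forall>\<phi>. rep G r \<phi> = (\<lambda>z. 0))"

lemma uq_moduleD:
  assumes "uq_module n b G"
  shows "\<And>g. lin_op (G g)" "\<And>x. lin_op (rep G x)"
    "\<And>x y \<phi>. rep G (x * y) \<phi> = rep G x (rep G y \<phi>)"
    "\<And>r \<phi>. r \<in> uq_relators n b \<Longrightarrow> rep G r \<phi> = (\<lambda>z. 0)"
  using assms lin_op_rep[of G] rep_mult[of G] by (auto simp: uq_module_def)

lemma rep_uq_ideal:
  assumes M: "uq_module n b G" and "x \<in> uq_ideal n b"
  shows "rep G x \<phi> = (\<lambda>z. 0)"
  using assms(2)
proof induction
  case zero
  show ?case by (rule rep_zero)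
next
  case (relator r x y)
  then show ?case
    by (simp add: uq_moduleD(3)[OF M] uq_moduleD(4)[OF M] lin_op_zero[OF uq_moduleD(2)[OF M]])
next
  case (add x y)
  then show ?case by (simp add: rep_add)
qed

lemma rep_cong_ideal:
  assumes "uq_module n b G" and "y - x \<in> uq_ideal n b"
  shows "rep G y \<phi> = rep G x \<phi>"
  using rep_uq_ideal[OF assms, of \<phi>] by (simp add: rep_minus fun_eq_iff)

lemma rep_center:
  assumes M: "uq_module n b G" and "x \<in> uq_center n b"
  shows "rep G x (G g \<phi>) = G g (rep G x \<phi>)"
proof -
  have "gen g * x - x * gen g \<in> uq_ideal n b"
    using assms(2) by (auto simp: uq_center_def)
  then have "rep G (gen g * x) \<phi> = rep G (x * gen g) \<phi>"
    by (rule rep_cong_ideal[OF M])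
  then show ?thesis by (simp add: uq_moduleD(3)[OF M] rep_gen)
qed

text \<open>The diagram automorphism of A_n. By truncated subtraction, indices outside
  \<open>{1..n}\<close> go to 0 or n + 1 and stay outside.\<close>

definition dual_gen :: "nat \<Rightarrow> uq_gen \<Rightarrow> uq_gen" where
  "dual_gen n g = (case g of Eg i \<Rightarrow> Eg (n + 1 - i) | Fg i \<Rightarrow> Fg (n + 1 - i)
     | Kr i \<Rightarrow> Kr (n + 1 - i) | Kr_inv i \<Rightarrow> Kr_inv (n + 1 - i))"

lemma dual_gen_simps [simp]:
  "dual_gen n (Eg i) = Eg (n + 1 - i)" "dual_gen n (Fg i) = Fg (n + 1 - i)"
  "dual_gen n (Kr i) = Kr (n + 1 - i)" "dual_gen n (Kr_inv i) = Kr_inv (n + 1 - i)"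
  by (simp_all add: dual_gen_def)

lemma rep_gen_power:
  assumes "\<And>g. lin_op (G g)"
  shows "rep G (gen g ^ m) \<phi> = (G g ^^ m) \<phi>"
proof -
  have "rep G (gen g) = G g" by (rule ext) (rule rep_gen)
  then show ?thesis by (simp add: rep_power[of G, OF assms])
qed

lemma rep_uK:
  assumes "\<And>g. lin_op (G g)"
  shows "rep G (uK n i) \<phi> = (G (Kr i) ^^ (n + 1)) \<phi>"
    and "rep G (uK_inv n i) \<phi> = (G (Kr_inv i) ^^ (n + 1)) \<phi>"
  unfolding Kroot_power_def by (simp_all add: rep_gen_power[of G, OF assms] nat_add_distrib del: power_Suc)

text \<open>Evaluating a relator in the twisted action is evaluating the relator with reversed
  indices in \<open>G\<close>, because \<open>cartan\<close> is invariant under the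
  reversal.\<close>

lemma uq_module_dual:
  fixes G :: "uq_gen \<Rightarrow> ('a \<Rightarrow> complex) \<Rightarrow> 'a \<Rightarrow> complex"
  assumes M: "uq_module n b G"
  shows "uq_module n b (\<lambda>g. G (dual_gen n g))"
  unfolding uq_module_def
proof (intro conjI allI ballI)
  note lin = uq_moduleD(1)[OF M]
  show "lin_op (G (dual_gen n g))" for g by (rule lin)
  have lin': "\<And>g. lin_op (G (dual_gen n g))" by (rule lin)
  have dom: "n + 1 - i \<in> {1..n} \<longleftrightarrow> i \<in> {1..n}" for i by auto
  have car: "cartan (n + 1 - i) (n + 1 - j) = cartan i j" if "i \<in> {1..n}" "j \<in> {1..n}" for i j
    using that unfolding cartan_def by (intro if_cong refl) auto
  have inj: "n + 1 - i = n + 1 - j \<longleftrightarrow> i = j" if "i \<in> {1..n}" "j \<in> {1..n}" for i j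
    using that by auto
  note ev = rep_add rep_minus rep_scal rep_gen rep_one rep_zero rep_mult[of G, OF lin]
    rep_mult[of "\<lambda>g. G (dual_gen n g)", OF lin'] rep_uK[of G, OF lin]
    rep_uK[of "\<lambda>g. G (dual_gen n g)", OF lin']
  fix r \<phi>
  assume "r \<in> uq_relators n b"
  then show "rep (\<lambda>g. G (dual_gen n g)) r \<phi> = (\<lambda>z. 0)"
  proof cases
    case (outside i g)
    then have "gen (dual_gen n g) \<in> uq_relators n b"
      using dom[of i] by (intro uq_relators.outside[of "n + 1 - i"]) auto
    from uq_moduleD(4)[OF M this, of \<phi>] show ?thesis unfolding outside(1) rep_gen .
  next
    case (K_left i)
    show ?thesis
      using uq_moduleD(4)[OF M uq_relators.K_left[OF K_left(2)[folded dom[of i]]], of \<phi>]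
      unfolding K_left(1) by (simp only: ev dual_gen_simps split: if_splits)
  next
    case (K_right i)
    show ?thesis
      using uq_moduleD(4)[OF M uq_relators.K_right[OF K_right(2)[folded dom[of i]]], of \<phi>]
      unfolding K_right(1) by (simp only: ev dual_gen_simps split: if_splits)
  next
    case (KK i j)
    show ?thesis
      using uq_moduleD(4)[OF M uq_relators.KK[OF KK(2)[folded dom[of i]] KK(3)[folded dom[of j]]], of \<phi>]
      unfolding KK(1) by (simp only: ev dual_gen_simps car[OF KK(2,3)] inj[OF KK(2,3)] split: if_splits)
  next
    case (Ke i j)
    show ?thesis
      using uq_moduleD(4)[OF M uq_relators.Ke[OF Ke(2)[folded dom[of i]] Ke(3)[folded dom[of j]]], of \<phi>]
      unfolding Ke(1) by (simp only: ev dual_gen_simps car[OF Ke(2,3)] inj[OF Ke(2,3)] split: if_splits)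
  next
    case (Kf i j)
    show ?thesis
      using uq_moduleD(4)[OF M uq_relators.Kf[OF Kf(2)[folded dom[of i]] Kf(3)[folded dom[of j]]], of \<phi>]
      unfolding Kf(1) by (simp only: ev dual_gen_simps car[OF Kf(2,3)] inj[OF Kf(2,3)] split: if_splits)
  next
    case (ef i j)
    show ?thesis
      using uq_moduleD(4)[OF M uq_relators.ef[OF ef(2)[folded dom[of i]] ef(3)[folded dom[of j]]], of \<phi>]
      unfolding ef(1) by (cases "i = j") (simp_all only: if_True if_False simp_thms ev dual_gen_simps car[OF ef(2,3)] inj[OF ef(2,3)])
  next
    case (ee i j)
    show ?thesis
      using uq_moduleD(4)[OF M uq_relators.ee[OF ee(2)[folded dom[of i]] ee(3)[folded dom[of j]] ee(4)[folded car[OF ee(2,3)]]], of \<phi>]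
      unfolding ee(1) by (simp only: ev dual_gen_simps car[OF ee(2,3)] inj[OF ee(2,3)] split: if_splits)
  next
    case (ff i j)
    show ?thesis
      using uq_moduleD(4)[OF M uq_relators.ff[OF ff(2)[folded dom[of i]] ff(3)[folded dom[of j]] ff(4)[folded car[OF ff(2,3)]]], of \<phi>]
      unfolding ff(1) by (simp only: ev dual_gen_simps car[OF ff(2,3)] inj[OF ff(2,3)] split: if_splits)
  next
    case (serre_e i j)
    show ?thesis
      using uq_moduleD(4)[OF M uq_relators.serre_e[OF serre_e(2)[folded dom[of i]] serre_e(3)[folded dom[of j]] serre_e(4)[folded car[OF serre_e(2,3)]]], of \<phi>]
      unfolding serre_e(1) by (simp only: ev dual_gen_simps car[OF serre_e(2,3)] inj[OF serre_e(2,3)] split: if_splits)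
  next
    case (serre_f i j)
    show ?thesis
      using uq_moduleD(4)[OF M uq_relators.serre_f[OF serre_f(2)[folded dom[of i]] serre_f(3)[folded dom[of j]] serre_f(4)[folded car[OF serre_f(2,3)]]], of \<phi>]
      unfolding serre_f(1) by (simp only: ev dual_gen_simps car[OF serre_f(2,3)] inj[OF serre_f(2,3)] split: if_splits)
  qed
qed

lemma Kr_inv_eigen:
  assumes M: "uq_module n b G" and i: "i \<in> {1..n}" and "c \<noteq> 0"
    and eigen: "G (Kr i) \<phi> = (\<lambda>z. c * \<phi> z)"
  shows "G (Kr_inv i) \<phi> = (\<lambda>z. inverse c * \<phi> z)"
proof -
  note lin = uq_moduleD(1)[OF M]
  have "G (Kr_inv i) (\<lambda>z. c * \<phi> z) = \<phi>"
    using uq_moduleD(4)[OF M uq_relators.K_left[OF i], of \<phi>]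
    by (simp add: rep_minus rep_mult[of G, OF lin] rep_gen rep_one eigen fun_eq_iff)
  then have "(\<lambda>z. c * G (Kr_inv i) \<phi> z) = \<phi>"
    by (simp add: lin_op_scale[OF lin])
  then show ?thesis
    using \<open>c \<noteq> 0\<close> by (auto simp: field_simps fun_eq_iff)
qed

lemma rep_Kroot_power:
  assumes M: "uq_module n b G" and i: "i \<in> {1..n}" and "c \<noteq> 0"
    and eigen: "G (Kr i) \<phi> = (\<lambda>z. c * \<phi> z)"
  shows "rep G (Kroot_power i m) \<phi> = (\<lambda>z. (c powi m) * \<phi> z)"
  using rep_power_eigen[of G "gen (Kr i)" \<phi> c "nat m"]
    rep_power_eigen[of G "gen (Kr_inv i)" \<phi> "inverse c" "nat (- m)"]
    eigen Kr_inv_eigen[OF assms] uq_moduleD(1)[OF M]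
  by (simp add: Kroot_power_def rep_gen power_int_def)

section \<open>Evaluation of the Casimirs on highest weight vectors\<close>

definition highest_weight ::
  "nat \<Rightarrow> (uq_gen \<Rightarrow> ('a \<Rightarrow> complex) \<Rightarrow> 'a \<Rightarrow> complex) \<Rightarrow> (nat \<Rightarrow> complex) \<Rightarrow> ('a \<Rightarrow> complex) \<Rightarrow> bool" where
  "highest_weight n G \<kappa> \<phi> \<longleftrightarrow> (\<forall>i\<in>{1..n}. G (Eg i) \<phi> = (\<lambda>z. 0) \<and>
     \<kappa> i \<noteq> 0 \<and> G (Kr i) \<phi> = (\<lambda>z. \<kappa> i * \<phi> z))"

definition leading_value :: "nat \<Rightarrow> real \<Rightarrow> (nat \<Rightarrow> complex) \<Rightarrow> nat \<Rightarrow> complex" where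
  "leading_value n b \<kappa> k = (-1) ^ n *
     (\<Sum>S\<in>fund_index n k. qpow b (\<Sum>i\<in>{1..n}. weight_coeff n S i) *
        (\<Prod>i\<in>{1..n}. \<kappa> i powi weight_coeff_scaled n S i))"

text \<open>Every term outside the leading part ends in some \<open>e\<close>, which annihilates
  \<phi>; the leading part is a polynomial in the \<open>Kr i\<close> and their inverses, for which
  \<phi> is an eigenvector.\<close>

lemma rep_casimir:
  assumes M: "uq_module n b G" and hw: "highest_weight n G \<kappa> \<phi>"
    and C: "casimirs n b C" and k: "k \<in> {1..n}"
  shows "rep G (C k) \<phi> = (\<lambda>z. leading_value n b \<kappa> k * \<phi> z)"
proof -
  note lin = uq_moduleD(1)[OF M]
  have "C k - casimir_leading n b k \<in> e_left_ideal n b"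
    using C k by (simp add: casimirs_def)
  then obtain x where x: "C k - casimir_leading n b k - (\<Sum>i\<in>{1..n}. x i * ue i) \<in> uq_ideal n b"
    unfolding e_left_ideal_def by blast
  have "rep G (C k) \<phi> = rep G (casimir_leading n b k + (\<Sum>i\<in>{1..n}. x i * ue i)) \<phi>"
    by (rule rep_cong_ideal[OF M]) (use x in \<open>simp add: algebra_simps\<close>)
  also have "\<dots> = rep G (casimir_leading n b k) \<phi>"
    using hw by (simp add: rep_add rep_sum uq_moduleD(3)[OF M] rep_gen highest_weight_def
        lin_op_zero[OF uq_moduleD(2)[OF M]])
  also have "\<dots> = (\<lambda>z. leading_value n b \<kappa> k * \<phi> z)"
  proof -
    have "rep G (prod_list (map (\<lambda>i. Kroot_power i (weight_coeff_scaled n S i)) [1..<n+1])) \<phi>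
        = (\<lambda>z. prod_list (map (\<lambda>i. \<kappa> i powi weight_coeff_scaled n S i) [1..<n+1]) * \<phi> z)" for S
      using hw by (intro rep_prod_list_eigen lin rep_Kroot_power[OF M])
        (auto simp: highest_weight_def)
    moreover have "prod_list (map (\<lambda>i. \<kappa> i powi weight_coeff_scaled n S i) [1..<n+1])
        = (\<Prod>i\<in>{1..n}. \<kappa> i powi weight_coeff_scaled n S i)" for S
      by (subst prod.distinct_set_conv_list[symmetric]) (auto intro!: prod.cong)
    ultimately show ?thesis
      by (simp add: casimir_leading_def leading_value_def rep_mult[of G, OF lin] rep_scal
          rep_sum sum_distrib_left sum_distrib_right mult.assoc del: upt_Suc)
  qed
  finally show ?thesis .
qed

section \<open>Casimir values\<close>

lemma qpow_add: "qpow b (x + y) = qpow b x * qpow b y"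
  by (simp add: qpow_def exp_add[symmetric] algebra_simps)

lemma qpow_zero [simp]: "qpow b 0 = 1"
  and qpow_nonzero [simp]: "qpow b x \<noteq> 0"
  by (simp_all add: qpow_def)

lemma qpow_of_nat: "qpow b (real k) = qpow b 1 ^ k"
  by (induction k) (simp_all add: qpow_add)

lemma qpow_minus: "qpow b (- x) = inverse (qpow b x)"
  by (simp add: qpow_def exp_minus)

lemma cnj_qpow: "cnj (qpow b x) = qpow b (- x)"
  by (simp add: qpow_def exp_cnj)

lemma norm_qpow [simp]: "norm (qpow b x) = 1"
  by (simp add: qpow_def)

text \<open>The k-th elementary symmetric function of q^(n-1), q^(n-3), ..., q^(1-n), that is, the
  balanced q-binomial coefficient.\<close>

definition qbin :: "nat \<Rightarrow> real \<Rightarrow> nat \<Rightarrow> complex" where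
  "qbin n b k = (\<Sum>S | S \<subseteq> {1..n} \<and> card S = k. qpow b (\<Sum>j\<in>S. real n + 1 - 2 * real j))"

text \<open>Up to sign, the k-th elementary symmetric function of \<mu> q^(n-1), ..., \<mu> q^(1-n)
  and \<mu>^(-n), split according to whether the last number is chosen.\<close>

definition casimir_value :: "nat \<Rightarrow> real \<Rightarrow> complex \<Rightarrow> nat \<Rightarrow> complex" where
  "casimir_value n b \<mu> k = (-1) ^ n * (\<mu> ^ k * qbin n b k + qbin n b (k - 1) / \<mu> ^ (n + 1 - k))"

text \<open>Adding the coefficients in the simple roots is pairing with \<rho>, which is additive
  over \<open>S\<close>; n + 2 - 2 j is the contribution of twice the j-th weight of the vector
  representation.\<close>

lemma sum_weight_coeff:
  assumes "S \<subseteq> {1..n+1}"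
  shows "(\<Sum>i\<in>{1..n}. weight_coeff n S i) = (\<Sum>j\<in>S. real n + 2 - 2 * real j)"
proof -
  have fin: "finite S" using assms finite_subset by blast
  have card: "real (card (S \<inter> {1..i})) = (\<Sum>j\<in>S. if j \<le> i then 1 else 0)" for i
  proof -
    have "{j\<in>S. j \<le> i} = S \<inter> {1..i}" using assms by auto
    then show ?thesis using fin by (simp add: sum.If_cases Int_def)
  qed
  have w: "weight_coeff n S i = 2 * (\<Sum>j\<in>S. if j \<le> i then 1 else 0) - 2 * real i * (real (card S) / real (n + 1))" for i
    unfolding card[symmetric]
    by (simp add: weight_coeff_def weight_coeff_scaled_def divide_simps) (simp add: algebra_simps)
  have inner: "(\<Sum>i\<in>{1..n}. if j \<le> i then 1 else 0) = real n + 1 - real j" if "j \<in> S" for j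
  proof -
    have "j \<in> {1..n+1}" using that assms by auto
    moreover have "{i\<in>{1..n}. j \<le> i} = {j..n}" if "1 \<le> j" using that by auto
    ultimately show ?thesis by (simp add: sum.If_cases Int_def of_nat_diff)
  qed
  have gauss: "(\<Sum>i\<in>{1..n}. real i) = real n * (real n + 1) / 2"
    by (induction n) (auto simp: field_simps)
  have "(\<Sum>i\<in>{1..n}. weight_coeff n S i)
      = 2 * (\<Sum>j\<in>S. \<Sum>i\<in>{1..n}. if j \<le> i then 1 else 0)
        - 2 * (\<Sum>i\<in>{1..n}. real i) * (real (card S) / real (n + 1))"
    unfolding w sum_subtractf by (subst sum.swap) (simp add: sum_distrib_left sum_distrib_right sum_divide_distrib)
  also have "\<dots> = 2 * (\<Sum>j\<in>S. real n + 1 - real j) - real n * real (card S)"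
  proof -
    have "(\<Sum>j\<in>S. \<Sum>i\<in>{1..n}. if j \<le> i then 1 else 0) = (\<Sum>j\<in>S. real n + 1 - real j)"
      by (rule sum.cong) (simp_all only: inner)
    then show ?thesis unfolding gauss by (simp add: divide_simps) (simp add: algebra_simps)
  qed
  also have "\<dots> = (\<Sum>j\<in>S. real n + 2 - 2 * real j)"
    by (simp add: sum_subtractf sum.distrib algebra_simps flip: sum_distrib_left sum_distrib_right)
  finally show ?thesis .
qed

lemma power_int_even: "(x::complex) \<noteq> 0 \<Longrightarrow> x powi (2 * m) = (x\<^sup>2) powi m"
  by (simp add: power_int_mult)

text \<open>The exponent of \<open>x\<close> is 2 k if n + 1 is not in \<open>S\<close> and -2 (n +
  1 - k) otherwise. Writing n + 2 - 2 j = 1 + (n + 1 - 2 j) splits off one q for each element of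
  \<open>S\<close> in \<open>{1..n}\<close>, so that \<open>x\<close> enters only through x^2
  q.\<close>

lemma leading_value_last:
  assumes k: "k \<in> {1..n}" and x: "x \<noteq> 0"
    and \<kappa>: "\<kappa> n = x" "\<And>i. i \<in> {1..<n} \<Longrightarrow> \<kappa> i = 1"
  shows "leading_value n b \<kappa> k = casimir_value n b (x\<^sup>2 * qpow b 1) k"
proof -
  let ?A = "\<lambda>k. {S. S \<subseteq> {1..n} \<and> card S = k}"
  let ?t = "\<lambda>S. qpow b (\<Sum>j\<in>S. real n + 2 - 2 * real j) * x powi weight_coeff_scaled n S n"
  let ?\<mu> = "x\<^sup>2 * qpow b 1"
  have n: "n \<in> {1..n}" using k by auto
  have fin: "finite (?A k)" for k by (rule finite_subset[of _ "Pow {1..n}"]) auto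
  have prod: "(\<Prod>i\<in>{1..n}. \<kappa> i powi weight_coeff_scaled n S i) = x powi weight_coeff_scaled n S n" for S
    using prod.mono_neutral_right[of "{1..n}" "{n}" "\<lambda>i. \<kappa> i powi weight_coeff_scaled n S i"] n \<kappa>
    by simp
  have index: "fund_index n k = ?A k \<union> insert (n+1) ` ?A (k - 1)" (is "_ = ?R")
  proof (intro set_eqI iffI)
    fix S assume S: "S \<in> fund_index n k"
    then have "finite S" using finite_subset[of S "{1..n+1}"] by (auto simp: fund_index_def)
    show "S \<in> ?R"
    proof (cases "n + 1 \<in> S")
      case True
      then have "S = insert (n + 1) (S - {n + 1})" "S - {n + 1} \<in> ?A (k - 1)"
        using S \<open>finite S\<close> by (auto simp: fund_index_def card_Diff_singleton)
      then show ?thesis by blast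
    next
      case False
      have "S \<subseteq> {1..n}"
      proof
        fix j assume "j \<in> S"
        then have "j \<in> {1..n+1}" "j \<noteq> n + 1" using S False by (auto simp: fund_index_def)
        then show "j \<in> {1..n}" by auto
      qed
      then show ?thesis using S by (auto simp: fund_index_def)
    qed
  next
    fix S assume S: "S \<in> ?R"
    have "card (insert (n+1) T) = k" if "T \<in> ?A (k - 1)" for T
    proof -
      have "finite T" "n + 1 \<notin> T" using that finite_subset[of T "{1..n}"] by auto
      then show ?thesis using that k by auto
    qed
    with S show "S \<in> fund_index n k" by (auto simp: fund_index_def)
  qed
  have disj: "?A k \<inter> insert (n+1) ` ?A (k - 1) = {}" by auto
  have inj: "inj_on (insert (n+1)) (?A (k - 1))"
  proof (rule inj_onI)
    fix S T assume "S \<in> ?A (k - 1)" "T \<in> ?A (k - 1)" "insert (n+1) S = insert (n+1) T"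
    moreover have "n + 1 \<notin> S" "n + 1 \<notin> T" using calculation(1,2) by auto
    ultimately show "S = T" by (metis insert_ident)
  qed
  have t1: "?t S = ?\<mu> ^ k * qpow b (\<Sum>j\<in>S. real n + 1 - 2 * real j)" if "S \<in> ?A k" for S
  proof -
    have a: "(\<Sum>j\<in>S. real n + 2 - 2 * real j) = real k + (\<Sum>j\<in>S. real n + 1 - 2 * real j)"
      using that by (simp add: sum.distrib sum_subtractf algebra_simps)
    have w: "weight_coeff_scaled n S n = 2 * int k"
      using that by (simp add: weight_coeff_scaled_def Int_absorb2 algebra_simps)
    show ?thesis
      unfolding a w qpow_add qpow_minus qpow_of_nat power_int_even[OF x] power_int_minus power_int_of_nat
      using x by (simp add: divide_simps power_mult_distrib)
  qed
  have t2: "?t (insert (n+1) S) = qpow b (\<Sum>j\<in>S. real n + 1 - 2 * real j) / ?\<mu> ^ (n + 1 - k)"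
    if "S \<in> ?A (k - 1)" for S
  proof -
    have S: "finite S" "n + 1 \<notin> S" using that finite_subset[of S "{1..n}"] by auto
    have a: "(\<Sum>j\<in>insert (n+1) S. real n + 2 - 2 * real j)
        = - real (n + 1 - k) + (\<Sum>j\<in>S. real n + 1 - 2 * real j)"
      using that S k by (simp add: sum.distrib sum_subtractf of_nat_diff algebra_simps)
    have w: "weight_coeff_scaled n (insert (n+1) S) n = 2 * (- int (n + 1 - k))"
    proof -
      have "insert (n+1) S \<inter> {1..n} = S" using that by auto
      then show ?thesis using that S k by (simp add: weight_coeff_scaled_def of_nat_diff algebra_simps)
    qed
    show ?thesis
      unfolding a w qpow_add qpow_minus qpow_of_nat power_int_even[OF x] power_int_minus power_int_of_nat
      using x by (simp add: divide_simps power_mult_distrib)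
  qed
  have "(\<Sum>S\<in>fund_index n k. qpow b (\<Sum>i\<in>{1..n}. weight_coeff n S i) *
        (\<Prod>i\<in>{1..n}. \<kappa> i powi weight_coeff_scaled n S i)) = (\<Sum>S\<in>fund_index n k. ?t S)"
    by (rule sum.cong) (simp_all only: prod sum_weight_coeff fund_index_def mem_Collect_eq)
  also have "\<dots> = (\<Sum>S\<in>?A k. ?t S) + (\<Sum>S\<in>?A (k - 1). ?t (insert (n+1) S))"
    by (simp only: index sum.union_disjoint[OF fin finite_imageI[OF fin] disj] sum.reindex[OF inj] o_def)
  also have "(\<Sum>S\<in>?A k. ?t (S)) = ?\<mu> ^ k * qbin n b k"
    unfolding qbin_def sum_distrib_left by (rule sum.cong[OF refl t1])
  also have "(\<Sum>S\<in>?A (k - 1). ?t (insert (n+1) S)) = qbin n b (k - 1) / ?\<mu> ^ (n + 1 - k)"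
    unfolding qbin_def sum_divide_distrib by (rule sum.cong[OF refl t2])
  finally show ?thesis by (simp add: leading_value_def casimir_value_def)
qed

text \<open>Mirror image of \<open>leading_value_last\<close> for the twisted module, whose
  nontrivial eigenvalue sits at node 1. The sets are split by membership of 1 and relabelled by
  \<open>Suc\<close>; all signs of the exponents flip, whence the inverted parameter.\<close>

lemma leading_value_first:
  assumes k: "k \<in> {1..n}" and x: "x \<noteq> 0"
    and \<kappa>: "\<kappa> 1 = x" "\<And>i. i \<in> {2..n} \<Longrightarrow> \<kappa> i = 1"
  shows "leading_value n b \<kappa> k = casimir_value n b (1 / (x\<^sup>2 * qpow b 1)) k"
proof -
  let ?A = "\<lambda>k. {S. S \<subseteq> {1..n} \<and> card S = k}"
  let ?t = "\<lambda>S. qpow b (\<Sum>j\<in>S. real n + 2 - 2 * real j) * x powi weight_coeff_scaled n S 1"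
  let ?\<mu> = "x\<^sup>2 * qpow b 1"
  let ?f = "\<lambda>S. insert 1 (Suc ` S)"
  have n: "1 \<in> {1..n}" using k by auto
  have fin: "finite (?A k)" for k by (rule finite_subset[of _ "Pow {1..n}"]) auto
  have prod: "(\<Prod>i\<in>{1..n}. \<kappa> i powi weight_coeff_scaled n S i) = x powi weight_coeff_scaled n S 1" for S
  proof -
    have "\<kappa> i = 1" if "i \<in> {1..n} - {1}" for i using that by (intro \<kappa>(2)) auto
    then show ?thesis
      using prod.mono_neutral_right[of "{1..n}" "{1}" "\<lambda>i. \<kappa> i powi weight_coeff_scaled n S i"] n \<kappa>(1)
      by simp
  qed
  have index: "fund_index n k = image Suc ` ?A k \<union> ?f ` ?A (k - 1)" (is "_ = ?R")
  proof (intro set_eqI iffI)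
    fix S assume S: "S \<in> fund_index n k"
    then have "finite S" using finite_subset[of S "{1..n+1}"] by (auto simp: fund_index_def)
    define T where "T = {j. j \<ge> 1 \<and> Suc j \<in> S}"
    have T: "S - {1} = Suc ` T"
    proof (intro set_eqI iffI)
      fix j assume "j \<in> S - {1}"
      then have "j \<in> S" "j \<ge> 2" using S by (auto simp: fund_index_def)
      then show "j \<in> Suc ` T" by (intro image_eqI[of _ _ "j - 1"]) (auto simp: T_def)
    qed (auto simp: T_def)
    have T': "T \<subseteq> {1..n}" using S by (auto simp: T_def fund_index_def)
    have cT: "card T = card (S - {1})" unfolding T by (simp add: card_image)
    show "S \<in> ?R"
    proof (cases "1 \<in> S")
      case True
      then have "S = ?f T" using insert_Diff[OF True] by (simp only: T)
      moreover have "card T = k - 1"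
        using True S cT by (simp add: fund_index_def card_Diff_singleton)
      ultimately show ?thesis using T' by blast
    next
      case False
      then have "S = Suc ` T" "card T = k" using T S cT by (auto simp: fund_index_def)
      then show ?thesis using T' by blast
    qed
  next
    fix S assume S: "S \<in> ?R"
    have "card (?f T) = k" if "T \<in> ?A (k - 1)" for T
    proof -
      have "finite (Suc ` T)" "1 \<notin> Suc ` T" using that finite_subset[of T "{1..n}"] by auto
      then show ?thesis using that k by (auto simp: card_image)
    qed
    with S show "S \<in> fund_index n k" by (auto simp: fund_index_def card_image)
  qed
  have notin: "1 \<notin> Suc ` S" if "S \<subseteq> {1..n}" for S using that by auto
  have disj: "image Suc ` ?A k \<inter> ?f ` ?A (k - 1) = {}" using notin by blast
  have inj1: "inj_on (image Suc) (?A k)"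
    by (rule inj_on_subset[of _ UNIV]) (auto simp: inj_image_eq_iff inj_on_def)
  have inj2: "inj_on ?f (?A (k - 1))"
  proof (rule inj_onI)
    fix S T assume ST: "S \<in> ?A (k - 1)" "T \<in> ?A (k - 1)" "?f S = ?f T"
    moreover have "1 \<notin> Suc ` S" "1 \<notin> Suc ` T" using ST(1,2) by (auto intro!: notin)
    ultimately have "Suc ` S = Suc ` T" by (metis insert_ident)
    then show "S = T" by (simp add: inj_image_eq_iff)
  qed
  have t1: "?t (Suc ` S) = (1 / ?\<mu>) ^ k * qpow b (\<Sum>j\<in>S. real n + 1 - 2 * real j)" if "S \<in> ?A k" for S
  proof -
    have a: "(\<Sum>j\<in>Suc ` S. real n + 2 - 2 * real j) = - real k + (\<Sum>j\<in>S. real n + 1 - 2 * real j)"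
      using that by (simp add: sum.reindex sum.distrib sum_subtractf card_image algebra_simps)
    have w: "weight_coeff_scaled n (Suc ` S) 1 = 2 * (- int k)"
    proof -
      have "Suc ` S \<inter> {1} = {}" using that notin[of S] by simp
      then show ?thesis using that by (simp add: weight_coeff_scaled_def card_image)
    qed
    show ?thesis
      unfolding a w qpow_add qpow_minus qpow_of_nat power_int_even[OF x] power_int_minus power_int_of_nat
      using x by (simp add: divide_simps power_mult_distrib)
  qed
  have t2: "?t (?f S) = qpow b (\<Sum>j\<in>S. real n + 1 - 2 * real j) / (1 / ?\<mu>) ^ (n + 1 - k)"
    if "S \<in> ?A (k - 1)" for S
  proof -
    have S: "finite S" "1 \<notin> Suc ` S" using that finite_subset[of S "{1..n}"] by auto
    have a: "(\<Sum>j\<in>?f S. real n + 2 - 2 * real j)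
        = real (n + 1 - k) + (\<Sum>j\<in>S. real n + 1 - 2 * real j)"
      using that S k
      by (simp add: sum.reindex sum.distrib sum_subtractf card_image of_nat_diff algebra_simps)
    have w: "weight_coeff_scaled n (?f S) 1 = 2 * int (n + 1 - k)"
    proof -
      have "?f S \<inter> {1} = {1}" by auto
      then show ?thesis using that S k
        by (simp add: weight_coeff_scaled_def of_nat_diff card_image algebra_simps)
    qed
    show ?thesis
      unfolding a w qpow_add qpow_minus qpow_of_nat power_int_even[OF x] power_int_minus power_int_of_nat
      using x by (simp add: divide_simps power_mult_distrib)
  qed
  have "(\<Sum>S\<in>fund_index n k. qpow b (\<Sum>i\<in>{1..n}. weight_coeff n S i) *
        (\<Prod>i\<in>{1..n}. \<kappa> i powi weight_coeff_scaled n S i)) = (\<Sum>S\<in>fund_index n k. ?t S)"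
    by (rule sum.cong) (simp_all only: prod sum_weight_coeff fund_index_def mem_Collect_eq)
  also have "\<dots> = (\<Sum>S\<in>?A k. ?t (Suc ` S)) + (\<Sum>S\<in>?A (k - 1). ?t (?f S))"
    by (simp only: index sum.union_disjoint[OF finite_imageI[OF fin] finite_imageI[OF fin] disj]
        sum.reindex[OF inj1] sum.reindex[OF inj2] o_def)
  also have "(\<Sum>S\<in>?A k. ?t (Suc ` S)) = (1 / ?\<mu>) ^ k * qbin n b k"
    unfolding qbin_def sum_distrib_left by (rule sum.cong[OF refl t1])
  also have "(\<Sum>S\<in>?A (k - 1). ?t (?f S)) = qbin n b (k - 1) / (1 / ?\<mu>) ^ (n + 1 - k)"
    unfolding qbin_def sum_divide_distrib by (rule sum.cong[OF refl t2])
  finally show ?thesis by (simp add: leading_value_def casimir_value_def)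
qed

section \<open>The minimal positive representations\<close>

text \<open>Shifting the coordinate \<open>z j\<close> by \<open>\<i> * b\<close> multiplies the functions \<open>ratio i\<close> by
  powers of \<open>q\<close>. The conventions for the coordinates \<open>0\<close> and \<open>n + 1\<close> make
  the formulas for the first \<open>e\<close>, the last \<open>f\<close> and the last \<open>K\<close> uniform.\<close>

definition zext :: "nat \<Rightarrow> real \<Rightarrow> (nat \<Rightarrow> complex) \<Rightarrow> nat \<Rightarrow> complex" where
  "zext n l z k = (if k = 0 then 0 else if k = Suc n then 2 * of_real l else z k)"

definition ratio :: "nat \<Rightarrow> real \<Rightarrow> real \<Rightarrow> nat \<Rightarrow> (nat \<Rightarrow> complex) \<Rightarrow> complex" where
  "ratio n b l i z = exp (of_real (pi * b) * (zext n l z i - zext n l z (i - 1))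
     + \<i> * of_real (pi * b\<^sup>2 / 2))"

definition K_root :: "nat \<Rightarrow> real \<Rightarrow> real \<Rightarrow> nat \<Rightarrow> (nat \<Rightarrow> complex) \<Rightarrow> complex" where
  "K_root n b l i z = exp (of_real (pi * b / (n + 1)) *
     (zext n l z (i + 1) + zext n l z (i - 1) - 2 * zext n l z i))"

definition shift :: "nat \<Rightarrow> complex \<Rightarrow> (nat \<Rightarrow> complex) \<Rightarrow> nat \<Rightarrow> complex" where
  "shift j t z = z(j := z j + t)"

lemma shift_commute: "shift i s (shift j t z) = shift j t (shift i s z)"
  by (auto simp: shift_def fun_eq_iff)

lemma shift_cancel [simp]:
  "shift i (- s) (shift i s z) = z" "shift i s (shift i (- s) z) = z"
  by (auto simp: shift_def fun_eq_iff)

lemma zext_shift: "j \<in> {1..n} \<Longrightarrow> zext n l (shift j t z) i = zext n l z i + (if i = j then t else 0)"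
  by (auto simp: zext_def shift_def)

lemma ratio_nonzero [simp]: "ratio n b l i z \<noteq> 0"
  and K_root_nonzero [simp]: "K_root n b l i z \<noteq> 0"
  by (simp_all add: ratio_def K_root_def)

lemma ratio_shift:
  assumes "j \<in> {1..n}" "i \<ge> 1"
  shows "ratio n b l i (shift j (\<i> * of_real b) z)
      = ratio n b l i z * (if i = j then qpow b 1 else if i = Suc j then inverse (qpow b 1) else 1)"
    and "ratio n b l i (shift j (- (\<i> * of_real b)) z)
      = ratio n b l i z * (if i = j then inverse (qpow b 1) else if i = Suc j then qpow b 1 else 1)"
  using assms
  by (auto simp: ratio_def zext_shift qpow_def exp_minus[symmetric] exp_add[symmetric]
      algebra_simps power2_eq_square)

lemma K_root_shift:
  assumes "i \<in> {1..n}" "j \<in> {1..n}"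
  shows "K_root n b l i (shift j (\<i> * of_real b * of_int s) z)
      = K_root n b l i z * qpow b (- cartan i j * s / (n + 1))"
  using assms
  by (auto simp: K_root_def zext_shift qpow_def exp_add[symmetric] cartan_def
      algebra_simps power2_eq_square)

text \<open>The phases pi b^2/2 of two consecutive ratios cancel, leaving the second difference of
  the coordinates.\<close>

lemma K_root_power:
  assumes "i \<in> {1..n}"
  shows "K_root n b l i z ^ (n + 1) = ratio n b l (i + 1) z / ratio n b l i z"
proof -
  let ?x = "zext n l z (i + 1) + zext n l z (i - 1) - 2 * zext n l z i"
  have "K_root n b l i z ^ (n + 1) = exp (of_nat (n + 1) * (of_real (pi * b / (n + 1)) * ?x))"
    unfolding K_root_def by (rule exp_of_nat_mult[symmetric])
  also have "of_nat (n + 1) * (of_real (pi * b / (n + 1)) * ?x) = of_real (pi * b) * ?x"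
    by (simp add: divide_simps del: of_nat_Suc)
  finally show ?thesis
    by (simp add: ratio_def exp_diff[symmetric] algebra_simps)
qed

section \<open>The generators as difference operators\<close>

lemma sum_delta:
  assumes "i \<in> {1..n}"
  shows "(\<Sum>k\<in>{1..n}. complex_of_real (delta i k) * z k) = z i"
    and "(\<Sum>k\<in>{1..n}. delta i k * y k) = y i"
proof -
  have "(\<Sum>k\<in>{1..n}. complex_of_real (delta i k) * z k) = (\<Sum>k\<in>{1..n}. if k = i then z k else 0)"
    by (rule sum.cong) (simp_all add: delta_def)
  then show "(\<Sum>k\<in>{1..n}. complex_of_real (delta i k) * z k) = z i" using assms by simp
  have "(\<Sum>k\<in>{1..n}. delta i k * y k) = (\<Sum>k\<in>{1..n}. if k = i then y k else 0)"
    by (rule sum.cong) (simp_all add: delta_def)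
  then show "(\<Sum>k\<in>{1..n}. delta i k * y k) = y i" using assms by simp
qed

text \<open>The condition \<open>a i * s = - 1\<close> makes the Baker-Campbell-Hausdorff phases of
  the two summands opposite, pi b^2/2 and its negative, so their coefficients are a ratio and its
  inverse. The case s = -1 serves the \<open>e\<close>, s = 1 the \<open>f\<close>.\<close>

lemma bracket_eq:
  assumes i: "i \<in> {1..n}"
    and t: "\<And>z. (\<Sum>k\<in>{1..n}. of_real (a k) * z k) + of_real d = zext n l z p - zext n l z (p - 1)"
    and a: "a i * s = - 1"
  shows "bracket n b a d (\<lambda>k. 2 * s * delta i k) \<phi>
    = (\<lambda>z. (ratio n b l p z + inverse (ratio n b l p z)) * \<phi> (shift i (- (\<i> * of_real (b * s))) z))"
proof
  fix z
  have pt: "(\<lambda>k. z k - \<i> * of_real (b * (2 * s * delta i k) / 2)) = shift i (- (\<i> * of_real (b * s))) z"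
    by (auto simp: shift_def delta_def)
  have ac: "(\<Sum>k\<in>{1..n}. a k * (2 * s * delta i k)) = - 2"
    using sum_delta(2)[OF i, of "\<lambda>k. 2 * s * a k"] a by (simp add: mult_ac)
  have "weyl n b a (\<lambda>k. 2 * s * delta i k) d \<phi> z
      = ratio n b l p z * \<phi> (shift i (- (\<i> * of_real (b * s))) z)"
    unfolding weyl_def t pt ac ratio_def by (simp add: field_simps)
  moreover have "weyl n b (\<lambda>k. - a k) (\<lambda>k. 2 * s * delta i k) (- d) \<phi> z
      = inverse (ratio n b l p z) * \<phi> (shift i (- (\<i> * of_real (b * s))) z)"
  proof -
    have t': "(\<Sum>k\<in>{1..n}. of_real (- a k) * z k) + of_real (- d) = - (zext n l z p - zext n l z (p - 1))"
      unfolding t[symmetric] by (simp add: sum_negf)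
    have ac': "(\<Sum>k\<in>{1..n}. - a k * (2 * s * delta i k)) = 2"
      using ac by (simp add: sum_negf)
    have "of_real (pi * b) * (- (zext n l z p - zext n l z (p - 1))) - \<i> * of_real (pi * b\<^sup>2 / 4 * 2)
        = - (of_real (pi * b) * (zext n l z p - zext n l z (p - 1)) + \<i> * of_real (pi * b\<^sup>2 / 2))"
      by (simp add: field_simps)
    then show ?thesis
      unfolding weyl_def pt t' ac' ratio_def by (simp only: exp_minus)
  qed
  ultimately show "bracket n b a d (\<lambda>k. 2 * s * delta i k) \<phi> z
    = (ratio n b l p z + inverse (ratio n b l p z)) * \<phi> (shift i (- (\<i> * of_real (b * s))) z)"
    by (simp add: bracket_def algebra_simps)
qed

lemma gen_op_Eg:
  assumes i: "i \<in> {1..n}"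
  shows "gen_op n b l (Eg i) \<phi> = (\<lambda>z. (ratio n b l i z + inverse (ratio n b l i z)) *
     \<phi> (shift i (\<i> * of_real b) z))"
proof (cases "i = 1")
  case True
  have "bracket n b (delta 1) 0 (\<lambda>k. 2 * (- 1) * delta 1 k) \<phi> =
    (\<lambda>z. (ratio n b l 1 z + inverse (ratio n b l 1 z)) * \<phi> (shift 1 (- (\<i> * of_real (b * (- 1)))) z))"
    by (rule bracket_eq) (use i True sum_delta(1)[of 1 n] in \<open>auto simp: zext_def delta_def\<close>)
  then show ?thesis using i True by simp
next
  case False
  have "bracket n b (\<lambda>k. delta i k - delta (i - 1) k) 0 (\<lambda>k. 2 * (- 1) * delta i k) \<phi> =
    (\<lambda>z. (ratio n b l i z + inverse (ratio n b l i z)) * \<phi> (shift i (- (\<i> * of_real (b * (- 1)))) z))"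
  proof (rule bracket_eq[OF i])
    have "i - 1 \<in> {1..n}" using i False by auto
    then show "(\<Sum>k\<in>{1..n}. of_real (delta i k - delta (i - 1) k) * z k) + of_real 0
      = zext n l z i - zext n l z (i - 1)" for z
      using i False by (simp add: left_diff_distrib sum_subtractf sum_delta[unfolded One_nat_def] del: atLeastAtMost_iff)
        (auto simp: zext_def)
  qed (use i False in \<open>auto simp: delta_def\<close>)
  then show ?thesis using i False by simp
qed

lemma gen_op_Fg:
  assumes i: "i \<in> {1..n}"
  shows "gen_op n b l (Fg i) \<phi> = (\<lambda>z. (ratio n b l (i + 1) z + inverse (ratio n b l (i + 1) z)) *
     \<phi> (shift i (- (\<i> * of_real b)) z))"
proof (cases "i = n")
  case True
  have "bracket n b (\<lambda>k. - delta n k) (2 * l) (\<lambda>k. 2 * 1 * delta n k) \<phi> =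
    (\<lambda>z. (ratio n b l (n + 1) z + inverse (ratio n b l (n + 1) z)) * \<phi> (shift n (- (\<i> * of_real (b * 1))) z))"
    by (rule bracket_eq)
      (use i True in \<open>simp_all add: sum_negf sum_delta[unfolded One_nat_def] zext_def del: atLeastAtMost_iff\<close>, simp_all add: delta_def)
  then show ?thesis using i True by simp
next
  case False
  have "bracket n b (\<lambda>k. - delta i k + delta (i + 1) k) 0 (\<lambda>k. 2 * 1 * delta i k) \<phi> =
    (\<lambda>z. (ratio n b l (i + 1) z + inverse (ratio n b l (i + 1) z)) * \<phi> (shift i (- (\<i> * of_real (b * 1))) z))"
  proof (rule bracket_eq[OF i])
    have "i + 1 \<in> {1..n}" using i False by auto
    then show "(\<Sum>k\<in>{1..n}. of_real (- delta i k + delta (i + 1) k) * z k) + of_real 0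
      = zext n l z (i + 1) - zext n l z (i + 1 - 1)" for z
      using i False by (simp add: left_diff_distrib sum_subtractf sum_delta[unfolded One_nat_def] del: atLeastAtMost_iff)
        (auto simp: zext_def)
  qed (use i False in \<open>auto simp: delta_def\<close>)
  then show ?thesis using i False by simp
qed

text \<open>Minus the Cartan matrix takes second differences. The boundary values of
  \<open>zext\<close> stand in for the missing neighbours and absorb the term 2 \<lambda> of the
  last node.\<close>

lemma sum_cartan:
  assumes i: "i \<in> {1..n}"
  shows "(\<Sum>k\<in>{1..n}. of_int (cartan i k) * z k) + (if i < n then 0 else - 2 * of_real l)
    = - (zext n l z (i + 1) + zext n l z (i - 1) - 2 * zext n l z i)"
proof -
  have "of_int (cartan i k) * z k = (if k = i then 2 * z k else 0) - (if k = i - 1 then z k else 0)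
      - (if k = i + 1 then z k else 0)" if "k \<in> {1..n}" for k
    using that i by (auto simp: cartan_def)
  then have "(\<Sum>k\<in>{1..n}. of_int (cartan i k) * z k) = (\<Sum>k\<in>{1..n}. (if k = i then 2 * z k else 0)
      - (if k = i - 1 then z k else 0) - (if k = i + 1 then z k else 0))"
    by (intro sum.cong) auto
  also have "\<dots> = 2 * z i - (if i - 1 \<in> {1..n} then z (i - 1) else 0) - (if i + 1 \<in> {1..n} then z (i + 1) else 0)"
    using i by (simp add: sum_subtractf)
  finally show ?thesis using i by (auto simp: zext_def)
qed

lemma gen_op_Kr:
  assumes i: "i \<in> {1..n}"
  shows "gen_op n b l (Kr i) \<phi> = (\<lambda>z. K_root n b l i z * \<phi> z)"
    and "gen_op n b l (Kr_inv i) \<phi> = (\<lambda>z. inverse (K_root n b l i z) * \<phi> z)"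
proof -
  have s: "of_real (pi * b) * ((\<Sum>k\<in>{1..n}. of_real (cartan i k / (n + 1)) * z k)
        + of_real (- (if i < n then 0 else 2 * l) / (n + 1)))
      = - (of_real (pi * b / (n + 1)) * (zext n l z (i + 1) + zext n l z (i - 1) - 2 * zext n l z i))" for z
  proof -
    have "of_real (pi * b) * ((\<Sum>k\<in>{1..n}. of_real (cartan i k / (n + 1)) * z k)
        + of_real (- (if i < n then 0 else 2 * l) / (n + 1)))
      = of_real (pi * b / (n + 1)) * ((\<Sum>k\<in>{1..n}. of_int (cartan i k) * z k)
        + (if i < n then 0 else - 2 * of_real l))"
    proof -
      have "(\<Sum>k\<in>{1..n}. of_real (cartan i k / (n + 1)) * z k)
          = (\<Sum>k\<in>{1..n}. of_int (cartan i k) * z k) / of_nat (n + 1)"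
        by (simp add: sum_divide_distrib)
      then show ?thesis by (simp only: of_real_divide of_real_minus of_real_add of_real_1 of_real_of_nat_eq)
        (simp add: right_diff_distrib diff_divide_distrib)
    qed
    then show ?thesis unfolding sum_cartan[OF i] by (simp add: algebra_simps)
  qed
  have w: "weyl n b a (\<lambda>_. 0) d \<phi> = (\<lambda>z. exp (of_real (pi * b) *
      ((\<Sum>k\<in>{1..n}. of_real (a k) * z k) + of_real d)) * \<phi> z)" for a d
    by (simp add: weyl_def)
  show "gen_op n b l (Kr_inv i) \<phi> = (\<lambda>z. inverse (K_root n b l i z) * \<phi> z)"
  proof -
    have "gen_op n b l (Kr_inv i) = weyl n b (\<lambda>j. cartan i j / (n + 1)) (\<lambda>_. 0)
        (- (if i < n then 0 else 2 * l) / (n + 1))"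
      using i by (auto simp: add.commute)
    then show ?thesis unfolding K_root_def exp_minus[symmetric] by (simp only: w s)
  qed
  have s': "of_real (pi * b) * ((\<Sum>k\<in>{1..n}. of_real (- cartan i k / (n + 1)) * z k)
        + of_real ((if i < n then 0 else 2 * l) / (n + 1)))
      = of_real (pi * b / (n + 1)) * (zext n l z (i + 1) + zext n l z (i - 1) - 2 * zext n l z i)" for z
    using arg_cong[OF s[of z], of uminus] by (simp add: sum_negf algebra_simps)
  show "gen_op n b l (Kr i) \<phi> = (\<lambda>z. K_root n b l i z * \<phi> z)"
  proof -
    have "gen_op n b l (Kr i) = weyl n b (\<lambda>j. - cartan i j / (n + 1)) (\<lambda>_. 0)
        ((if i < n then 0 else 2 * l) / (n + 1))"
      using i by (auto simp: add.commute)
    then show ?thesis unfolding K_root_def by (simp only: w s')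
  qed
qed

section \<open>The relations of the quantum group\<close>

lemma gen_op_outside:
  assumes "i \<notin> {1..n}"
  shows "gen_op n b l (Eg i) \<phi> = (\<lambda>z. 0)" "gen_op n b l (Fg i) \<phi> = (\<lambda>z. 0)"
    "gen_op n b l (Kr i) \<phi> = (\<lambda>z. 0)" "gen_op n b l (Kr_inv i) \<phi> = (\<lambda>z. 0)"
  using assms by simp_all

lemma lin_op_gen_op: "lin_op (gen_op n b l g)"
  by (cases g) (simp_all add: lin_op_def bracket_def weyl_def algebra_simps)

lemma Kr_power:
  assumes "i \<in> {1..n}"
  shows "(gen_op n b l (Kr i) ^^ m) \<phi> = (\<lambda>z. K_root n b l i z ^ m * \<phi> z)"
    and "(gen_op n b l (Kr_inv i) ^^ m) \<phi> = (\<lambda>z. inverse (K_root n b l i z) ^ m * \<phi> z)"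
  by (induction m) (simp_all add: gen_op_Kr[OF assms] mult_ac del: gen_op.simps)

text \<open>Once all shifts are moved to the right by \<open>ratio_shift\<close> and
  \<open>Kshift\<close>, each relation among the \<open>e\<close>, \<open>f\<close> and
  \<open>K\<close> becomes an identity between their coefficients, rational in the ratios and powers
  of q.\<close>

lemma uq_module_gen_op: "uq_module n b (gen_op n b l)"
  unfolding uq_module_def
proof (intro conjI allI ballI ext)
  show "lin_op (gen_op n b l g)" for g by (rule lin_op_gen_op)
  fix r \<phi> z
  assume "r \<in> uq_relators n b"
  note ev = rep_add rep_minus rep_scal rep_gen rep_one rep_zero
    rep_mult[of "gen_op n b l", OF lin_op_gen_op] rep_uK[of "gen_op n b l", OF lin_op_gen_op]
  note op = gen_op_Eg gen_op_Fg gen_op_Kr ratio_shift Kr_power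
  have q: "qpow b (- 1) = inverse (qpow b 1)" "qpow b 1 \<noteq> 0" by (simp_all add: qpow_minus)
  have Kshift: "K_root n b l i (shift j (\<i> * of_real b) z) = K_root n b l i z * qpow b (- cartan i j / (n + 1))"
    "K_root n b l i (shift j (- (\<i> * of_real b)) z) = K_root n b l i z * qpow b (cartan i j / (n + 1))"
    if "i \<in> {1..n}" "j \<in> {1..n}" for i j z
    using K_root_shift[OF that, of b l 1 z] K_root_shift[OF that, of b l "- 1" z] by (simp_all add: add.commute)
  from \<open>r \<in> uq_relators n b\<close> show "rep (gen_op n b l) r \<phi> z = 0"
  proof cases
    case (outside i g)
    then show ?thesis by (auto simp: rep_gen gen_op_outside simp del: gen_op.simps)
  next
    case (K_left i)
    then show ?thesis by (simp add: ev op del: gen_op.simps atLeastAtMost_iff)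
  next
    case (K_right i)
    then show ?thesis by (simp add: ev op del: gen_op.simps atLeastAtMost_iff)
  next
    case (KK i j)
    then show ?thesis by (simp add: ev op del: gen_op.simps atLeastAtMost_iff)
  next
    case (Ke i j)
    have "qpow b (cartan i j / (n + 1)) * qpow b (- cartan i j / (n + 1)) = 1"
      by (simp flip: qpow_add)
    then show ?thesis unfolding Ke(1) using Ke(2,3)
      by (simp add: ev op Kshift algebra_simps del: gen_op.simps atLeastAtMost_iff)
  next
    case (Kf i j)
    have "qpow b (- cartan i j / (n + 1)) * qpow b (cartan i j / (n + 1)) = 1"
      by (simp flip: qpow_add)
    then show ?thesis unfolding Kf(1) using Kf(2,3)
      by (simp add: ev op Kshift algebra_simps del: gen_op.simps atLeastAtMost_iff)
  next
    case (ef i j)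
    show ?thesis
    proof (cases "i = j")
      case True
      have j: "j \<ge> 1" using ef(3) by simp
      \<comment> \<open>With r = \<open>ratio j\<close> and r' = \<open>ratio (j + 1)\<close>, the
        terms r r' and 1/(r r') cancel in the commutator. The mixed terms leave (q - 1/q) (r/r' -
        r'/r), and r'/r is the action of K_j.\<close>
      show ?thesis unfolding ef(1) True simp_thms if_True ev Kr_power[OF ef(3)] power_inverse K_root_power[OF ef(3)]
        using ef(3) j
        by (simp add: ev op q K_root_power power_inverse del: gen_op.simps atLeastAtMost_iff) (simp add: field_simps)
    next
      case False
      \<comment> \<open>For i = j + 1 both generators have the coefficient r + 1/r with r =
        \<open>ratio i\<close>, and both shifts multiply r by q, so the two orders agree. Otherwise
        neither shift affects the coefficient of the other generator.\<close>
      then consider "i = Suc j" | "i \<noteq> Suc j" by blast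
      moreover have "i \<ge> 1" "j \<ge> 1" using ef(2,3) by auto
      ultimately show ?thesis unfolding ef(1) using ef(2,3) False
        by cases (simp_all add: ev op q shift_commute[of i _ j] shift_commute[of "Suc j" _ j] del: gen_op.simps atLeastAtMost_iff)
    qed
  next
    case (ee i j)
    then have "i \<noteq> j" "i \<noteq> Suc j" "j \<noteq> Suc i" by (auto simp: cartan_def)
    moreover have "i \<ge> 1" "j \<ge> 1" using ee(2,3) by auto
    ultimately show ?thesis unfolding ee(1) using ee(2,3)
      by (simp add: ev op q shift_commute[of j _ i] del: gen_op.simps atLeastAtMost_iff)
  next
    case (ff i j)
    then have "i \<noteq> j" "i \<noteq> Suc j" "j \<noteq> Suc i" by (auto simp: cartan_def)
    moreover have "i \<ge> 1" "j \<ge> 1" using ff(2,3) by auto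
    ultimately show ?thesis unfolding ff(1) using ff(2,3)
      by (simp add: ev op q shift_commute[of j _ i] del: gen_op.simps atLeastAtMost_iff)
  next
    case (serre_e i j)
    then have ij: "i = Suc j \<or> j = Suc i" by (auto simp: cartan_def split: if_splits)
    have "i \<ge> 1" "j \<ge> 1" using serre_e(2,3) by auto
    with ij show ?thesis unfolding serre_e(1) using serre_e(2,3)
      by (elim disjE) (simp_all add: ev op q shift_commute[of "Suc i" _ i] shift_commute[of "Suc j" _ j] del: gen_op.simps atLeastAtMost_iff, simp_all add: field_simps)
  next
    case (serre_f i j)
    then have ij: "i = Suc j \<or> j = Suc i" by (auto simp: cartan_def split: if_splits)
    have "i \<ge> 1" "j \<ge> 1" using serre_f(2,3) by auto
    with ij show ?thesis unfolding serre_f(1) using serre_f(2,3)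
      by (elim disjE) (simp_all add: ev op q shift_commute[of "Suc i" _ i] shift_commute[of "Suc j" _ j] del: gen_op.simps atLeastAtMost_iff, simp_all add: field_simps)
  qed
qed

text \<open>The point at which all \<open>e\<^sub>i\<close> annihilate the indicator function:
  \<open>ratio i\<close> takes the value \<open>\<i> * q\<close> there.\<close>

definition top_point :: "real \<Rightarrow> nat \<Rightarrow> complex" where
  "top_point b k = \<i> * of_real (of_nat k * (b + 1 / b) / 2)"

definition top_vector :: "real \<Rightarrow> cfun" where
  "top_vector b z = (if z = top_point b then 1 else 0)"

definition tau :: "nat \<Rightarrow> real \<Rightarrow> real \<Rightarrow> real" where
  "tau n b l = exp (4 * pi * b * l / (n + 1))"

lemma zext_top_point:
  "k \<le> n \<Longrightarrow> zext n l (top_point b) k = of_nat k * (\<i> * of_real ((b + 1 / b) / 2))"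
  by (simp add: zext_def top_point_def)

text \<open>Of each step i (b + 1/b)/2, the part with b combines with the phase pi b^2/2 to q, and
  the part with 1/b gives exp(i pi/2) = i.\<close>

lemma ratio_top_point:
  assumes "0 < b" and "i \<in> {1..n}"
  shows "ratio n b l i (top_point b) = \<i> * qpow b 1"
proof -
  have "ratio n b l i (top_point b) = exp (\<i> * of_real (pi / 2) + \<i> * of_real (pi * b\<^sup>2))"
    unfolding ratio_def
  proof (rule arg_cong[where f = exp])
    have "zext n l (top_point b) i - zext n l (top_point b) (i - 1) = \<i> * of_real ((b + 1 / b) / 2)"
      using assms by (cases i) (simp_all add: zext_top_point distrib_right del: of_real_divide)
    then show "of_real (pi * b) * (zext n l (top_point b) i - zext n l (top_point b) (i - 1))
        + \<i> * of_real (pi * b\<^sup>2 / 2) = \<i> * of_real (pi / 2) + \<i> * of_real (pi * b\<^sup>2)"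
      using assms by (simp add: field_simps power2_eq_square)
  qed
  also have "exp (\<i> * of_real (pi / 2)) = \<i>"
    by (simp add: complex_eq_iff Re_exp Im_exp)
  then have "exp (\<i> * of_real (pi / 2) + \<i> * of_real (pi * b\<^sup>2)) = \<i> * qpow b 1"
    by (simp add: exp_add qpow_def)
  finally show ?thesis .
qed

text \<open>The coordinates of \<open>top_point\<close> are linear in the index, so second
  differences vanish before the last node, where the boundary value 2 l breaks linearity. The clause
  on the norm is what later tells two modules apart.\<close>

lemma K_root_top_point:
  assumes "0 < b"
  shows "i \<in> {1..<n} \<Longrightarrow> K_root n b l i (top_point b) = 1"
    and "n \<ge> 1 \<Longrightarrow> (K_root n b l n (top_point b))\<^sup>2 * qpow b 1 = - of_real (tau n b l)"
    and "n \<ge> 1 \<Longrightarrow> norm (K_root n b l n (top_point b)) = exp (2 * pi * b * l / (n + 1))"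
proof -
  show "K_root n b l i (top_point b) = 1" if "i \<in> {1..<n}"
  proof -
    have "zext n l (top_point b) (i + 1) + zext n l (top_point b) (i - 1) - 2 * zext n l (top_point b) i = 0"
      using that by (cases i) (simp_all add: zext_top_point distrib_right del: of_real_divide)
    then show ?thesis unfolding K_root_def by simp
  qed
  assume n: "n \<ge> 1"
  have Z: "zext n l (top_point b) (n + 1) + zext n l (top_point b) (n - 1) - 2 * zext n l (top_point b) n
      = 2 * of_real l - of_nat (n + 1) * (\<i> * of_real ((b + 1 / b) / 2))"
  proof -
    have "zext n l (top_point b) (n + 1) = 2 * of_real l" by (simp add: zext_def)
    then show ?thesis
      using n by (cases n) (simp_all add: zext_top_point distrib_right del: of_real_divide)
  qed
  have "of_real (pi * b / (n + 1)) * (2 * of_real l - of_nat (n + 1) * (\<i> * of_real ((b + 1 / b) / 2)))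
      = of_real (2 * pi * b * l / (n + 1)) - \<i> * of_real (pi * (b\<^sup>2 + 1) / 2)"
  proof -
    have "pi * b / c * (c * ((b + 1 / b) / 2)) = pi * (b\<^sup>2 + 1) / 2" if "c \<noteq> 0" for c
      using that assms by (simp add: field_simps power2_eq_square)
    from this[of "real (n + 1)"]
    have "pi * b / real (n + 1) * (real (n + 1) * ((b + 1 / b) / 2)) = pi * (b\<^sup>2 + 1) / 2"
      by linarith
    moreover have "pi * b / real (n + 1) * (2 * l) = 2 * pi * b * l / (n + 1)" by simp
    moreover have "of_real x * (2 * of_real l - of_nat N * (\<i> * of_real w))
        = of_real (x * (2 * l)) - \<i> * complex_of_real (x * (real N * w))" for x w N
      by (simp add: algebra_simps)
    ultimately show ?thesis by (simp only:)
  qed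
  then have K: "K_root n b l n (top_point b)
      = exp (of_real (2 * pi * b * l / (n + 1)) - \<i> * of_real (pi * (b\<^sup>2 + 1) / 2))"
    unfolding K_root_def Z by simp
  show "norm (K_root n b l n (top_point b)) = exp (2 * pi * b * l / (n + 1))"
    unfolding K norm_exp_eq_Re by simp
  have "4 * pi * b * l / (n + 1) = 2 * (2 * pi * b * l / (n + 1))" by simp
  then have "(K_root n b l n (top_point b))\<^sup>2 * qpow b 1 = exp (of_real (4 * pi * b * l / (n + 1)) + - (\<i> * of_real pi))"
    unfolding K qpow_def power2_eq_square exp_add[symmetric]
    by (intro arg_cong[where f = exp]) (simp only:, simp add: algebra_simps add_divide_distrib)
  also have "\<dots> = - of_real (tau n b l)"
    unfolding exp_add tau_def exp_minus exp_of_real by simp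
  finally show "(K_root n b l n (top_point b))\<^sup>2 * qpow b 1 = - of_real (tau n b l)" .
qed

text \<open>\<open>e_i\<close> moves the support to the point one shift before
  \<open>top_point\<close>. There the ratio i q has been divided by q, and i + 1/i = 0.\<close>

lemma gen_op_top_vector:
  assumes "0 < b" and "i \<in> {1..n}"
  shows "gen_op n b l (Eg i) (top_vector b) = (\<lambda>z. 0)"
    and "gen_op n b l (Kr i) (top_vector b) = (\<lambda>z. K_root n b l i (top_point b) * top_vector b z)"
proof -
  show "gen_op n b l (Eg i) (top_vector b) = (\<lambda>z. 0)"
  proof
    fix z
    show "gen_op n b l (Eg i) (top_vector b) z = 0"
    proof (cases "shift i (\<i> * of_real b) z = top_point b")
      case True
      then have z: "z = shift i (- (\<i> * of_real b)) (top_point b)"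
        by (metis shift_cancel(1))
      have "ratio n b l i z = \<i>"
        unfolding z using assms by (subst ratio_shift(2)[OF assms(2)]) (simp_all add: ratio_top_point[OF assms])
      then show ?thesis
        unfolding gen_op_Eg[OF assms(2)] by simp
    next
      case False
      then show ?thesis
        unfolding gen_op_Eg[OF assms(2)] by (simp add: top_vector_def)
    qed
  qed
  show "gen_op n b l (Kr i) (top_vector b) = (\<lambda>z. K_root n b l i (top_point b) * top_vector b z)"
    unfolding gen_op_Kr[OF assms(2)] by (auto simp: top_vector_def)
qed

lemma rep_casimir_top:
  assumes b: "0 < b" and C: "casimirs n b C" and k: "k \<in> {1..n}"
  shows "rep (gen_op n b l) (C k) (top_vector b)
    = (\<lambda>z. casimir_value n b (- of_real (tau n b l)) k * top_vector b z)"
proof -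
  let ?\<kappa> = "\<lambda>i. K_root n b l i (top_point b)"
  have "highest_weight n (gen_op n b l) ?\<kappa> (top_vector b)"
    unfolding highest_weight_def using gen_op_top_vector[OF b] by simp
  note rep_casimir[OF uq_module_gen_op this C k]
  also have "leading_value n b ?\<kappa> k = casimir_value n b (- of_real (tau n b l)) k"
    using leading_value_last[OF k, of "?\<kappa> n" ?\<kappa> b] K_root_top_point[OF b] k by simp
  finally show ?thesis .
qed

text \<open>The twist moves the nontrivial eigenvalue to node 1, which inverts the parameter, and
  inverting \<open>tau\<close> is changing the sign of \<open>l\<close>. So the twisted module for
  \<open>l\<close> matches the untwisted one for \<open>- l\<close> on all Casimirs.\<close>

lemma rep_dual_casimir_top:
  assumes b: "0 < b" and C: "casimirs n b C" and k: "k \<in> {1..n}"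
  shows "rep (\<lambda>g. gen_op n b l (dual_gen n g)) (C k) (top_vector b)
    = (\<lambda>z. casimir_value n b (- of_real (tau n b (- l))) k * top_vector b z)"
proof -
  let ?\<kappa> = "\<lambda>i. K_root n b l (n + 1 - i) (top_point b)"
  have "n + 1 - i \<in> {1..n}" if "i \<in> {1..n}" for i using that by auto
  then have "highest_weight n (\<lambda>g. gen_op n b l (dual_gen n g)) ?\<kappa> (top_vector b)"
    unfolding highest_weight_def using gen_op_top_vector[OF b] by (simp del: gen_op.simps atLeastAtMost_iff)
  note rep_casimir[OF uq_module_dual[OF uq_module_gen_op] this C k]
  also have "leading_value n b ?\<kappa> k = casimir_value n b (1 / (- of_real (tau n b l))) k"
  proof -
    have x: "K_root n b l n (top_point b) \<noteq> 0" by simp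
    have "?\<kappa> i = 1" if "i \<in> {2..n}" for i
      using that by (intro K_root_top_point(1)[OF b]) auto
    then have "leading_value n b ?\<kappa> k
        = casimir_value n b (1 / ((K_root n b l n (top_point b))\<^sup>2 * qpow b 1)) k"
      by (intro leading_value_first[OF k x]) simp
    then show ?thesis using k by (simp add: K_root_top_point(2)[OF b])
  qed
  also have "1 / (- complex_of_real (tau n b l)) = - of_real (tau n b (- l))"
    by (simp add: tau_def exp_minus field_simps)
  finally show ?thesis .
qed

section \<open>The parameter is not a root of unity\<close>

definition uq_cong :: "nat \<Rightarrow> real \<Rightarrow> uq_free \<Rightarrow> uq_free \<Rightarrow> bool" where
  "uq_cong n b x y \<longleftrightarrow> x - y \<in> uq_ideal n b"

lemma uq_ideal_mult: "x \<in> uq_ideal n b \<Longrightarrow> u * x * v \<in> uq_ideal n b"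
proof (induction rule: uq_ideal.induct)
  case (relator r x y)
  then show ?case
    using uq_ideal.relator[of r n b "u * x" "y * v"] by (simp add: mult.assoc)
qed (auto simp: distrib_left distrib_right intro: uq_ideal.intros)

lemma uq_ideal_uminus: "x \<in> uq_ideal n b \<Longrightarrow> - x \<in> uq_ideal n b"
  using uq_ideal_mult[of x n b "- 1" 1] by simp

lemma uq_cong_refl [simp]: "uq_cong n b x x"
  by (simp add: uq_cong_def uq_ideal.zero)

lemma uq_cong_sym: "uq_cong n b x y \<Longrightarrow> uq_cong n b y x"
  using uq_ideal_uminus[of "x - y" n b] by (simp add: uq_cong_def)

lemma uq_cong_trans [trans]: "uq_cong n b x y \<Longrightarrow> uq_cong n b y z \<Longrightarrow> uq_cong n b x z"
  using uq_ideal.add[of "x - y" n b "y - z"] by (simp add: uq_cong_def)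

lemma uq_cong_add: "uq_cong n b x x' \<Longrightarrow> uq_cong n b y y' \<Longrightarrow> uq_cong n b (x + y) (x' + y')"
  using uq_ideal.add[of "x - x'" n b "y - y'"] by (simp add: uq_cong_def algebra_simps)

lemma uq_cong_mult: "uq_cong n b x x' \<Longrightarrow> uq_cong n b y y' \<Longrightarrow> uq_cong n b (x * y) (x' * y')"
  using uq_ideal.add[OF uq_ideal_mult[of "x - x'" n b 1 y] uq_ideal_mult[of "y - y'" n b x' 1]]
  by (simp add: uq_cong_def algebra_simps)

lemma uq_cong_relator: "x - y \<in> uq_relators n b \<Longrightarrow> uq_cong n b x y"
  using uq_ideal.relator[of "x - y" n b 1 1] by (simp add: uq_cong_def)

lemma scal_mult: "scal c * scal d = scal (c * d)"
  by (simp add: scal_def mult_single)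

lemma scal_commute: "scal c * x = x * scal c"
proof (induction x rule: free_algebra_induct)
  case (single w d)
  show ?case by (simp add: scal_def mult_single mult.commute)
qed (simp add: distrib_left distrib_right)

lemma free_algebra_generator_induct [case_names scal gen add mult]:
  fixes x :: "'g free_algebra"
  assumes scal: "\<And>c. P (scal c)" and gen: "\<And>g. P (gen g)"
    and add: "\<And>x y. P x \<Longrightarrow> P y \<Longrightarrow> P (x + y)" and mult: "\<And>x y. P x \<Longrightarrow> P y \<Longrightarrow> P (x * y)"
  shows "P x"
proof (induction x rule: free_algebra_induct)
  case (single w c)
  have "P (Poly_Mapping.single (Word gs) c)" for gs
  proof (induction gs arbitrary: c)
    case Nil
    show ?case using scal[of c] by (simp add: scal_def zero_free_monoid_def)
  next
    case (Cons g gs)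
    have "Poly_Mapping.single (Word (g # gs)) c = gen g * Poly_Mapping.single (Word gs) c"
      by (simp add: gen_def mult_single plus_free_monoid_def)
    then show ?case using mult[OF gen Cons] by simp
  qed
  then show ?case by (cases w) simp
qed (rule add)

lemma power_q_commute:
  assumes "uq_cong n b (x * y) (scal c * y * x)"
  shows "uq_cong n b (x ^ m * y) (scal (c ^ m) * y * x ^ m)"
proof (induction m)
  case 0
  show ?case by (simp add: scal_def)
next
  case (Suc m)
  have "uq_cong n b (x * (x ^ m * y)) (x * (scal (c ^ m) * y * x ^ m))"
    by (intro uq_cong_mult Suc uq_cong_refl)
  also have "x * (scal (c ^ m) * y * x ^ m) = scal (c ^ m) * (x * y) * x ^ m"
    by (metis mult.assoc scal_commute)
  also have "uq_cong n b (scal (c ^ m) * (x * y) * x ^ m) (scal (c ^ m) * (scal c * y * x) * x ^ m)"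
    by (intro uq_cong_mult assms uq_cong_refl)
  finally show ?case
    by (simp add: mult.assoc scal_mult[symmetric] mult.commute[of c])
qed

text \<open>Moving \<open>Kr 1 ^ m\<close> past a generator costs q^(m a/(n+1)) with an integer a,
  which is a power of 1.\<close>

lemma Kr_power_central:
  assumes n: "n \<ge> 1" and q: "qpow b (real m / (n + 1)) = 1"
  shows "gen (Kr 1) ^ m \<in> uq_center n b"
proof -
  let ?K = "gen (Kr 1) :: uq_free"
  let ?C = "\<lambda>x. uq_cong n b (x * ?K ^ m) (?K ^ m * x)"
  have one: "1 \<in> {1..n}" using n by simp
  have qc: "qpow b (of_int a / (n + 1)) ^ m = 1" for a
  proof -
    have nat: "qpow b (real s / (n + 1)) ^ m = 1" for s
    proof -
      have "qpow b (real s / (n + 1)) ^ m = qpow b (real m / (n + 1)) ^ s"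
        by (simp add: qpow_def exp_of_nat_mult[symmetric] algebra_simps)
      then show ?thesis using q by (simp add: add.commute)
    qed
    show ?thesis
    proof (cases "a \<ge> 0")
      case True
      then show ?thesis using nat[of "nat a"] by simp
    next
      case False
      then have "of_int a / (n + 1) = - (real (nat (- a)) / (n + 1))" by simp
      then show ?thesis using nat[of "nat (- a)"] by (simp only: qpow_minus power_inverse) simp
    qed
  qed
  have qcomm: "?C y" if "uq_cong n b (?K * y) (scal (qpow b (of_int a / (n + 1))) * y * ?K)" for y a
    using uq_cong_sym[OF power_q_commute[OF that, of m]] qc[of a] by (simp add: scal_def)
  have out: "?C (gen g)" if "i \<notin> {1..n}" "g \<in> {Eg i, Fg i, Kr i, Kr_inv i}" for g i
  proof -
    have "uq_cong n b (gen g) 0"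
      using uq_relators.outside[OF that] by (intro uq_cong_relator) simp
    then have "uq_cong n b (gen g * ?K ^ m) (0 * ?K ^ m)" "uq_cong n b (?K ^ m * 0) (?K ^ m * gen g)"
      by (intro uq_cong_mult uq_cong_sym[of n b _ 0] uq_cong_refl; assumption)+
    from uq_cong_trans[OF this(1)[unfolded mult_zero_left] this(2)[unfolded mult_zero_right]]
    show ?thesis .
  qed
  have Kr: "?C (gen (Kr i))" if "i \<in> {1..n}" for i
    using uq_cong_relator[OF uq_relators.KK[OF one that]]
    by (intro qcomm[of _ 0]) (simp add: scal_def)
  \<comment> \<open>Commutation with \<open>Kr_inv i\<close> is not among the relators; it follows
    from commutation with \<open>Kr i\<close> by multiplying with \<open>Kr_inv i\<close> on both
    sides.\<close>
  have Kr_inv: "?C (gen (Kr_inv i))" if i: "i \<in> {1..n}" for i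
  proof -
    let ?g = "gen (Kr i)" and ?h = "gen (Kr_inv i)"
    have gh: "uq_cong n b (?g * ?h) 1" and hg: "uq_cong n b (?h * ?g) 1"
      using i by (simp_all only: uq_cong_relator uq_relators.K_left uq_relators.K_right)
    have "uq_cong n b (?h * ?K ^ m * 1) (?h * ?K ^ m * (?g * ?h))"
      by (intro uq_cong_mult uq_cong_refl uq_cong_sym[OF gh])
    also have "?h * ?K ^ m * (?g * ?h) = ?h * (?K ^ m * ?g) * ?h" by (simp add: mult.assoc)
    also have "uq_cong n b (?h * (?K ^ m * ?g) * ?h) (?h * (?g * ?K ^ m) * ?h)"
      by (intro uq_cong_mult uq_cong_refl uq_cong_sym[OF Kr[OF i]])
    also have "?h * (?g * ?K ^ m) * ?h = (?h * ?g) * (?K ^ m * ?h)" by (simp add: mult.assoc)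
    also have "uq_cong n b ((?h * ?g) * (?K ^ m * ?h)) (1 * (?K ^ m * ?h))"
      by (intro uq_cong_mult uq_cong_refl hg)
    finally show ?thesis by simp
  qed
  have e: "?C (ue i)" if "i \<in> {1..n}" for i
    by (rule qcomm[OF uq_cong_relator[OF uq_relators.Ke[OF one that]]])
  have f: "?C (uf i)" if "i \<in> {1..n}" for i
    using uq_cong_relator[OF uq_relators.Kf[OF one that, of b]]
    by (intro qcomm[of _ "- cartan 1 i"]) simp
  have "?C x" for x
  proof (induction x rule: free_algebra_generator_induct)
    case (scal c)
    show ?case by (simp add: scal_commute)
  next
    case (gen g)
    obtain i where g: "g \<in> {Eg i, Fg i, Kr i, Kr_inv i}" by (cases g) auto
    show ?case
    proof (cases "i \<in> {1..n}")
      case True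
      with g show ?thesis by (elim insertE emptyE) (simp_all only: e f Kr Kr_inv)
    qed (rule out[OF _ g])
  next
    case (add x y)
    then show ?case by (simp add: distrib_left distrib_right uq_cong_add)
  next
    case (mult x y)
    have "uq_cong n b (x * (y * ?K ^ m)) (x * (?K ^ m * y))"
      by (intro uq_cong_mult uq_cong_refl mult)
    also have "x * (?K ^ m * y) = (x * ?K ^ m) * y" by (simp add: mult.assoc)
    also have "uq_cong n b ((x * ?K ^ m) * y) ((?K ^ m * x) * y)"
      by (intro uq_cong_mult uq_cong_refl mult)
    finally show ?case by (simp add: mult.assoc)
  qed
  then show ?thesis by (simp add: uq_center_def uq_cong_def)
qed

text \<open>A power of \<open>K\<^sub>1\<close> that is central at a root of unity is not a polynomial in the
  Casimirs: it distinguishes a minimal representation from the one with opposite parameter twisted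
  by the diagram automorphism, on whose highest weight vectors all Casimirs agree.\<close>

lemma casimirs_generic:
  assumes n: "n \<ge> 2" and b: "0 < b" and C: "casimirs n b C"
    and q: "qpow b (real m / (n + 1)) = 1"
  shows "m = 0"
proof (rule ccontr)
  assume "m \<noteq> 0"
  \<comment> \<open>With opposite parameters the Casimirs have equal values at \<open>?v\<close>.
    Since 1 < n, \<open>Kr 1\<close> fixes \<open>?v\<close> in \<open>?G\<close>; in
    \<open>?H\<close> it acts as \<open>Kr n\<close> does untwisted, by a scalar of norm exp (2 pi
    b/(n+1)).\<close>
  let ?G = "gen_op n b (- 1)" and ?H = "\<lambda>g. gen_op n b 1 (dual_gen n g)" and ?v = "top_vector b"
  note G = uq_module_gen_op[of n b "- 1"]
  note H = uq_module_dual[OF uq_module_gen_op[of n b 1]]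
  have one: "1 \<in> {1..n}" and nn: "n \<in> {1..n}" using n by auto
  have v: "?v (top_point b) = 1" by (simp add: top_vector_def)
  have "gen (Kr 1) ^ m \<in> uq_center n b"
    using n q by (intro Kr_power_central) (auto simp: add.commute)
  then have "gen (Kr 1) ^ m \<in> uq_subalgebra n b (C ` {1..n})"
    using C by (simp add: casimirs_def)
  then have "\<exists>c. rep ?G (gen (Kr 1) ^ m) ?v = (\<lambda>z. c * ?v z) \<and> rep ?H (gen (Kr 1) ^ m) ?v = (\<lambda>z. c * ?v z)"
  proof induction
    case (const c)
    show ?case by (auto simp: rep_scal)
  next
    case (base x)
    then obtain k where k: "k \<in> {1..n}" "x = C k" by blast
    show ?case
      using rep_casimir_top[OF b C k(1), of "- 1"] rep_dual_casimir_top[OF b C k(1), of 1] k(2) by auto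
  next
    case (add x y)
    then obtain c d where "rep ?G x ?v = (\<lambda>z. c * ?v z)" "rep ?H x ?v = (\<lambda>z. c * ?v z)"
      "rep ?G y ?v = (\<lambda>z. d * ?v z)" "rep ?H y ?v = (\<lambda>z. d * ?v z)" by blast
    then show ?case by (intro exI[of _ "c + d"]) (simp add: rep_add distrib_right)
  next
    case (mult x y)
    then obtain c d where "rep ?G x ?v = (\<lambda>z. c * ?v z)" "rep ?H x ?v = (\<lambda>z. c * ?v z)"
      "rep ?G y ?v = (\<lambda>z. d * ?v z)" "rep ?H y ?v = (\<lambda>z. d * ?v z)" by blast
    then show ?case
      by (intro exI[of _ "c * d"]) (simp add: uq_moduleD(3)[OF G] uq_moduleD(3)[OF H]
          lin_op_scale[OF uq_moduleD(2)[OF G]] lin_op_scale[OF uq_moduleD(2)[OF H]] mult_ac)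
  next
    case (cong x y)
    then show ?case by (simp add: rep_cong_ideal[OF G] rep_cong_ideal[OF H])
  qed
  moreover have "rep ?G (gen (Kr 1) ^ m) ?v = (\<lambda>z. 1 ^ m * ?v z)"
    using K_root_top_point(1)[OF b, of 1 n "- 1"] n
    by (intro rep_power_eigen lin_op_gen_op)
      (simp add: rep_gen gen_op_top_vector(2)[OF b one] del: gen_op.simps One_nat_def)
  moreover have "rep ?H (gen (Kr 1) ^ m) ?v = (\<lambda>z. K_root n b 1 n (top_point b) ^ m * ?v z)"
    by (intro rep_power_eigen lin_op_gen_op)
      (simp add: rep_gen gen_op_top_vector(2)[OF b nn] del: gen_op.simps)
  ultimately have "K_root n b 1 n (top_point b) ^ m = 1"
    using v by (auto simp: fun_eq_iff)
  then have "exp (2 * pi * b * 1 / (n + 1)) ^ m = 1"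
    using K_root_top_point(3)[OF b, of n 1] n by (metis norm_one norm_power one_le_numeral order_trans)
  then have "exp (real m * (2 * pi * b * 1 / (n + 1))) = 1"
    by (simp only: exp_of_nat_mult)
  then have "real m * (2 * pi * b * 1 / (n + 1)) = 0"
    by (simp only: exp_eq_one_iff)
  then show False using b \<open>m \<noteq> 0\<close> by simp
qed

section \<open>Central elements act by scalars\<close>

definition shifted :: "real \<Rightarrow> (nat \<Rightarrow> int) \<Rightarrow> (nat \<Rightarrow> complex) \<Rightarrow> nat \<Rightarrow> complex" where
  "shifted b s z = (\<lambda>k. z k + \<i> * of_real b * of_int (s k))"

definition exp_monom :: "nat \<Rightarrow> real \<Rightarrow> (nat \<Rightarrow> int) \<Rightarrow> (nat \<Rightarrow> complex) \<Rightarrow> complex" where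
  "exp_monom n b m z = exp (of_real (pi * b / (n + 1)) * (\<Sum>k\<in>{1..n}. of_int (m k) * z k))"

text \<open>Sums of a Laurent polynomial in the exp (pi b z_k/(n+1)) times a translation by integer
  multiples of i b in the first n coordinates; the denominator n + 1 accommodates the adjoined roots
  of the K_i.\<close>

inductive diff_op :: "nat \<Rightarrow> real \<Rightarrow> (cfun \<Rightarrow> cfun) \<Rightarrow> bool" for n :: nat and b :: real where
  zero: "diff_op n b (\<lambda>\<phi> z. 0)"
| ident: "diff_op n b (\<lambda>\<phi>. \<phi>)"
| add: "diff_op n b A \<Longrightarrow> diff_op n b B \<Longrightarrow> diff_op n b (\<lambda>\<phi> z. A \<phi> z + B \<phi> z)"
| monom: "diff_op n b A \<Longrightarrow> (\<And>k. k \<notin> {1..n} \<Longrightarrow> s k = 0) \<Longrightarrow>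
    diff_op n b (\<lambda>\<phi> z. \<alpha> * exp_monom n b m z * A \<phi> (shifted b s z))"

lemma diff_op_scale: "diff_op n b A \<Longrightarrow> diff_op n b (\<lambda>\<phi> z. c * A \<phi> z)"
  using diff_op.monom[of n b A "\<lambda>k. 0" c "\<lambda>k. 0"] by (simp add: exp_monom_def shifted_def)

lemma diff_op_sum: "(\<And>i. i \<in> I \<Longrightarrow> diff_op n b (A i)) \<Longrightarrow> diff_op n b (\<lambda>\<phi> z. \<Sum>i\<in>I. A i \<phi> z)"
  by (induction I rule: infinite_finite_induct) (simp_all add: diff_op.zero diff_op.add)

text \<open>The integrality conditions place the exponents and the translations in the lattices
  underlying \<open>exp_monom\<close> and \<open>shifted\<close>.\<close>

lemma diff_op_weyl:
  assumes A: "diff_op n b A" and a: "\<And>k. a k * real (n + 1) \<in> \<int>"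
    and c: "\<And>k. c k / 2 \<in> \<int>" "\<And>k. k \<notin> {1..n} \<Longrightarrow> c k = 0"
  shows "diff_op n b (\<lambda>\<phi>. weyl n b a c d (A \<phi>))"
proof -
  obtain m where m: "a k * real (n + 1) = of_int (m k)" for k
  proof -
    have "\<exists>m. a k * real (n + 1) = of_int m" for k using a[of k] by (auto elim: Ints_cases)
    then show ?thesis using that by metis
  qed
  obtain s where s: "c k / 2 = of_int (s k)" for k
  proof -
    have "\<exists>m. c k / 2 = of_int m" for k using c(1)[of k] by (auto elim: Ints_cases)
    then show ?thesis using that by metis
  qed
  have a': "a k = of_int (m k) / real (n + 1)" for k
    unfolding m[symmetric] by simp
  have c': "c k = 2 * of_int (s k)" for k
    using s[of k] by simp
  let ?\<alpha> = "exp (of_real (pi * b * d) - \<i> * of_real (pi * b\<^sup>2 / 4 * (\<Sum>k\<in>{1..n}. a k * c k)))"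
  have "(\<Sum>k\<in>{1..n}. complex_of_real (a k) * z k) = (\<Sum>k\<in>{1..n}. of_int (m k) * z k) / of_nat (n + 1)" for z
    unfolding a' by (simp add: sum_divide_distrib)
  then have e: "exp (of_real (pi * b) * ((\<Sum>k\<in>{1..n}. of_real (a k) * z k) + of_real d)
          - \<i> * of_real (pi * b\<^sup>2 / 4 * (\<Sum>k\<in>{1..n}. a k * c k))) = ?\<alpha> * exp_monom n b m z" for z
    unfolding exp_monom_def exp_add[symmetric] by (intro arg_cong[where f = exp]) (simp add: algebra_simps)
  have pt: "(\<lambda>k. z k - \<i> * of_real (b * c k / 2)) = shifted b (\<lambda>k. - s k) z" for z
    by (simp add: shifted_def c' mult.assoc)
  have "weyl n b a c d (A \<phi>) = (\<lambda>z. ?\<alpha> * exp_monom n b m z * A \<phi> (shifted b (\<lambda>k. - s k) z))" for \<phi>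
    unfolding weyl_def e pt ..
  moreover have "- s k = 0" if "k \<notin> {1..n}" for k
    using c(2)[OF that] c'[of k] by simp
  ultimately show ?thesis
    using diff_op.monom[OF A, of "\<lambda>k. - s k" ?\<alpha> m] by simp
qed

lemma diff_op_gen_op:
  assumes A: "diff_op n b A"
  shows "diff_op n b (\<lambda>\<phi>. gen_op n b l g (A \<phi>))"
proof -
  have br: "diff_op n b (\<lambda>\<phi>. bracket n b a d c (A \<phi>))"
    if "\<And>k. a k \<in> \<int>" "\<And>k. c k / 2 \<in> \<int>" "\<And>k. k \<notin> {1..n} \<Longrightarrow> c k = 0" for a c d
    unfolding bracket_def using that by (intro diff_op.add diff_op_weyl A Ints_mult) auto
  have kr: "diff_op n b (\<lambda>\<phi>. weyl n b (\<lambda>j. of_int (x j) / (n + 1)) (\<lambda>_. 0) d (A \<phi>))"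
    for x :: "nat \<Rightarrow> int" and d
    by (rule diff_op_weyl[OF A]) simp_all
  show ?thesis
  proof (cases g)
    case (Eg i)
    show ?thesis unfolding Eg gen_op.simps
      by (auto simp: diff_op.zero intro!: br) (auto simp: delta_def)
  next
    case (Fg i)
    show ?thesis unfolding Fg gen_op.simps
      by (auto simp: diff_op.zero intro!: br) (auto simp: delta_def)
  next
    case (Kr i)
    show ?thesis
      using kr[of "\<lambda>j. - cartan i j" "(if i < n then 0 else 2 * l) / (n + 1)"]
      unfolding Kr by (cases "i \<in> {1..n}") (auto simp: diff_op.zero add.commute)
  next
    case (Kr_inv i)
    show ?thesis
      using kr[of "\<lambda>j. cartan i j" "- (if i < n then 0 else 2 * l) / (n + 1)"]
      unfolding Kr_inv by (cases "i \<in> {1..n}") (auto simp: diff_op.zero add.commute)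
  qed
qed

lemma diff_op_rep: "diff_op n b (rep (gen_op n b l) x)"
proof -
  have "diff_op n b (foldr (gen_op n b l) ws)" for ws
  proof (induction ws)
    case Nil
    show ?case by (simp add: id_def diff_op.ident)
  next
    case (Cons g ws)
    show ?case using diff_op_gen_op[OF Cons] by (simp add: comp_def)
  qed
  then show ?thesis
    unfolding rep_def by (intro diff_op_sum diff_op_scale)
qed

lemma shifted_shifted: "shifted b s (shifted b t z) = shifted b (\<lambda>k. s k + t k) z"
  by (simp add: shifted_def algebra_simps)

lemma shifted_eq_iff: "b \<noteq> 0 \<Longrightarrow> shifted b s z = shifted b t z \<longleftrightarrow> s = t"
  by (auto simp: shifted_def fun_eq_iff)

text \<open>Only the finiteness of the set of shifts is recorded. The exponential form of
  coefficients is needed just for the image of the constant 1, in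
  \<open>diff_op_exp_poly\<close>.\<close>

lemma diff_op_normal_form:
  assumes "diff_op n b A"
  shows "\<exists>S F. finite S \<and> (\<forall>s\<in>S. \<forall>k. k \<notin> {1..n} \<longrightarrow> s k = 0) \<and>
    (\<forall>\<phi> z. A \<phi> z = (\<Sum>s\<in>S. F s z * \<phi> (shifted b s z)))"
  using assms
proof induction
  case zero
  show ?case by (rule exI[of _ "{}"]) simp
next
  case ident
  show ?case by (rule exI[of _ "{\<lambda>k. 0}"], rule exI[of _ "\<lambda>s z. 1"]) (simp add: shifted_def)
next
  case (add A B)
  obtain S F where S: "finite S" "\<forall>s\<in>S. \<forall>k. k \<notin> {1..n} \<longrightarrow> s k = 0"
    and A: "\<And>\<phi> z. A \<phi> z = (\<Sum>s\<in>S. F s z * \<phi> (shifted b s z))" using add.IH(1) by blast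
  obtain T G where T: "finite T" "\<forall>s\<in>T. \<forall>k. k \<notin> {1..n} \<longrightarrow> s k = 0"
    and B: "\<And>\<phi> z. B \<phi> z = (\<Sum>s\<in>T. G s z * \<phi> (shifted b s z))" using add.IH(2) by blast
  have A': "A \<phi> z = (\<Sum>s\<in>S \<union> T. (if s \<in> S then F s z else 0) * \<phi> (shifted b s z))" for \<phi> z
    unfolding A by (rule sum.mono_neutral_cong_left) (use S T in auto)
  have B': "B \<phi> z = (\<Sum>s\<in>S \<union> T. (if s \<in> T then G s z else 0) * \<phi> (shifted b s z))" for \<phi> z
    unfolding B by (rule sum.mono_neutral_cong_left) (use S T in auto)
  show ?case
    unfolding A' B' using S T
    by (intro exI[of _ "S \<union> T"] exI[of _ "\<lambda>s z. (if s \<in> S then F s z else 0) + (if s \<in> T then G s z else 0)"])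
      (auto simp: sum.distrib distrib_right)
next
  case (monom A s \<alpha> m)
  obtain S F where S: "finite S" "\<forall>s\<in>S. \<forall>k. k \<notin> {1..n} \<longrightarrow> s k = 0"
    and A: "\<And>\<phi> z. A \<phi> z = (\<Sum>s\<in>S. F s z * \<phi> (shifted b s z))" using monom.IH by blast
  let ?f = "\<lambda>t k. t k + s k"
  have inj: "inj_on ?f S" by (auto simp: inj_on_def fun_eq_iff)
  let ?F = "\<lambda>t z. \<alpha> * exp_monom n b m z * F (\<lambda>k. t k - s k) (shifted b s z)"
  have "\<alpha> * exp_monom n b m z * A \<phi> (shifted b s z) = (\<Sum>t\<in>?f ` S. ?F t z * \<phi> (shifted b t z))" for \<phi> z
    unfolding A sum.reindex[OF inj] by (simp add: shifted_shifted sum_distrib_left mult_ac)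
  then show ?case
    using S monom.hyps(2) by (intro exI[of _ "?f ` S"] exI[of _ ?F]) auto
qed

section \<open>Exponential polynomials\<close>

definition exp_poly :: "nat \<Rightarrow> real \<Rightarrow> cfun \<Rightarrow> bool" where
  "exp_poly n b f \<longleftrightarrow> (\<exists>xs. \<forall>z. f z = (\<Sum>(\<alpha>, m)\<leftarrow>xs. \<alpha> * exp_monom n b m z))"

lemma exp_monom_add: "exp_monom n b m z * exp_monom n b m' z = exp_monom n b (\<lambda>k. m k + m' k) z"
  unfolding exp_monom_def exp_add[symmetric]
  by (intro arg_cong[where f = exp]) (simp add: sum.distrib distrib_right distrib_left)

lemma exp_monom_shifted: "exp_monom n b m (shifted b s z) = exp_monom n b m z * exp_monom n b m (shifted b s (\<lambda>k. 0))"
  unfolding exp_monom_def exp_add[symmetric]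
  by (intro arg_cong[where f = exp]) (simp add: shifted_def sum.distrib distrib_left)

lemma diff_op_exp_poly: "diff_op n b A \<Longrightarrow> exp_poly n b (A (\<lambda>z. 1))"
proof (induction rule: diff_op.induct)
  case zero
  show ?case unfolding exp_poly_def by (rule exI[of _ "[]"]) simp
next
  case ident
  show ?case unfolding exp_poly_def by (rule exI[of _ "[(1, \<lambda>k. 0)]"]) (simp add: exp_monom_def)
next
  case (add A B)
  then obtain xs ys where "\<And>z. A (\<lambda>z. 1) z = (\<Sum>(\<alpha>, m)\<leftarrow>xs. \<alpha> * exp_monom n b m z)"
    "\<And>z. B (\<lambda>z. 1) z = (\<Sum>(\<alpha>, m)\<leftarrow>ys. \<alpha> * exp_monom n b m z)"
    unfolding exp_poly_def by blast
  then show ?case unfolding exp_poly_def by (intro exI[of _ "xs @ ys"]) simp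
next
  case (monom A s \<alpha> m)
  then obtain xs where xs: "\<And>z. A (\<lambda>z. 1) z = (\<Sum>(\<alpha>, m)\<leftarrow>xs. \<alpha> * exp_monom n b m z)"
    unfolding exp_poly_def by blast
  let ?h = "\<lambda>(\<beta>, m'). (\<alpha> * \<beta> * exp_monom n b m' (shifted b s (\<lambda>k. 0)), \<lambda>k. m k + m' k)"
  have "\<alpha> * exp_monom n b m z * (\<Sum>(\<beta>, m')\<leftarrow>xs. \<beta> * exp_monom n b m' (shifted b s z))
      = (\<Sum>(\<beta>, m')\<leftarrow>map ?h xs. \<beta> * exp_monom n b m' z)" for z
  proof (induction xs)
    case (Cons x xs)
    obtain \<beta> m' where x: "x = (\<beta>, m')" by (cases x)
    have "\<alpha> * exp_monom n b m z * (\<beta> * exp_monom n b m' (shifted b s z))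
        = \<alpha> * \<beta> * exp_monom n b m' (shifted b s (\<lambda>k. 0)) * exp_monom n b (\<lambda>k. m k + m' k) z"
      unfolding exp_monom_add[symmetric] exp_monom_shifted[of n b m' s z] by (simp add: mult_ac)
    then show ?case using Cons unfolding x by (simp add: distrib_left)
  qed simp
  then show ?case unfolding exp_poly_def xs by blast
qed

lemma exp_poly_cong:
  assumes "exp_poly n b f" and "\<And>k. k \<in> {1..n} \<Longrightarrow> z k = z' k"
  shows "f z = f z'"
proof -
  have "exp_monom n b m z = exp_monom n b m z'" for m
    unfolding exp_monom_def by (intro arg_cong[where f = exp] arg_cong2[where f = times] sum.cong refl assms(2))
  then show ?thesis using assms(1) by (auto simp: exp_poly_def)
qed

lemma exp_poly_coordinate:
  assumes "exp_poly n b f" and i: "i \<in> {1..n}"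
  shows "\<exists>xs :: (complex \<times> int) list. \<forall>t. f (z(i := t)) =
    (\<Sum>(\<alpha>, m)\<leftarrow>xs. \<alpha> * exp (of_real (pi * b / (n + 1)) * of_int m * t))"
proof -
  obtain xs where xs: "\<And>z. f z = (\<Sum>(\<alpha>, m)\<leftarrow>xs. \<alpha> * exp_monom n b m z)"
    using assms(1) by (auto simp: exp_poly_def)
  have e: "exp_monom n b m (z(i := t)) = exp_monom n b m (z(i := 0)) * exp (of_real (pi * b / (n + 1)) * of_int (m i) * t)" for m t
  proof -
    have "(\<Sum>k\<in>{1..n}. of_int (m k) * (z(i := u)) k) = of_int (m i) * u + (\<Sum>k\<in>{1..n} - {i}. of_int (m k) * z k)" for u
      using i by (subst sum.remove[of _ i]) (auto intro!: sum.cong)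
    then show ?thesis
      unfolding exp_monom_def exp_add[symmetric] by (intro arg_cong[where f = exp]) (simp add: algebra_simps)
  qed
  have "f (z(i := t)) = (\<Sum>(\<alpha>, m)\<leftarrow>map (\<lambda>(\<alpha>, m). (\<alpha> * exp_monom n b m (z(i := 0)), m i)) xs.
      \<alpha> * exp (of_real (pi * b / (n + 1)) * of_int m * t))" for t
    unfolding xs e[of _ t] by (induction xs) (auto simp: mult_ac)
  then show ?thesis by blast
qed

text \<open>Multiplied by a power of \<open>X = exp (c * t)\<close>, such a function is a polynomial \<open>p\<close> in \<open>X\<close>,
  and \<open>p (\<omega> * X)\<close> is a multiple of \<open>p X\<close>.\<close>

lemma periodic_exp_sum_const:
  fixes xs :: "(complex \<times> int) list" and c d :: complex and t0 :: complex
  defines "g \<equiv> \<lambda>t. \<Sum>(\<alpha>, m)\<leftarrow>xs. \<alpha> * exp (c * of_int m * t)"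
  assumes c: "c \<in> \<real>" "c \<noteq> 0"
    and period: "\<And>r :: real. g (t0 + of_real r + d) = g (t0 + of_real r)"
    and generic: "\<And>m :: nat. exp (c * d) ^ m = 1 \<Longrightarrow> m = 0"
  shows "g t = g t'"
proof -
  have "\<exists>N :: nat. \<forall>(\<alpha>, m)\<in>set xs. - int N \<le> m"
  proof (induction xs)
    case (Cons x xs)
    then obtain N where N: "\<forall>(\<alpha>, m)\<in>set xs. - int N \<le> m" by blast
    obtain \<alpha> m where x: "x = (\<alpha>, m)" by (cases x)
    show ?case
      by (rule exI[of _ "max N (nat (- m))"]) (use N x in fastforce)
  qed simp
  then obtain N :: nat where N: "\<And>\<alpha> m. (\<alpha>, m) \<in> set xs \<Longrightarrow> - int N \<le> m" by blast
  define p where "p = (\<Sum>(\<alpha>, m)\<leftarrow>xs. monom \<alpha> (nat (m + int N)))"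
  have p: "poly p (exp (c * t)) = exp (c * t) ^ N * g t" for t
    unfolding p_def g_def using N
  proof (induction xs)
    case (Cons x xs)
    obtain \<alpha> m where x: "x = (\<alpha>, m)" by (cases x)
    have "exp (c * t) ^ nat (m + int N) = exp (c * t) ^ N * exp (c * of_int m * t)"
    proof -
      have "- int N \<le> m" using Cons.prems[of \<alpha> m] x by simp
      then have "of_nat (nat (m + int N)) * (c * t) = of_nat N * (c * t) + c * of_int m * t"
        by (simp add: algebra_simps)
      then show ?thesis by (simp only: exp_of_nat_mult[symmetric] exp_add[symmetric])
    qed
    moreover have "poly (\<Sum>(\<alpha>, m)\<leftarrow>xs. monom \<alpha> (nat (m + int N))) (exp (c * t))
        = exp (c * t) ^ N * (\<Sum>(\<alpha>, m)\<leftarrow>xs. \<alpha> * exp (c * of_int m * t))"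
      using Cons.prems by (intro Cons.IH) auto
    ultimately show ?case unfolding x by (simp add: poly_monom algebra_simps)
  qed simp
  let ?\<omega> = "exp (c * d)"
  \<comment> \<open>On the given line p (\<omega> X) = (\<omega> X)^N g = \<omega>^N p X by
    periodicity, so \<open>?r\<close> vanishes at all these X.\<close>
  let ?r = "pcompose p [:0, ?\<omega>:] - smult (?\<omega> ^ N) p"
  have root: "poly ?r (exp (c * (t0 + of_real r))) = 0" for r :: real
  proof -
    have "?\<omega> * exp (c * (t0 + of_real r)) = exp (c * (t0 + of_real r + d))"
      by (simp add: exp_add[symmetric] algebra_simps)
    then show ?thesis
      using p[of "t0 + of_real r + d"] p[of "t0 + of_real r"] period[of r]
      by (simp add: poly_pcompose mult.commute[of _ ?\<omega>] power_mult_distrib[symmetric])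
  qed
  \<comment> \<open>For real nonzero c the modulus of X determines r, which gives infinitely many
    zeros.\<close>
  have "infinite (range (\<lambda>r :: real. exp (c * (t0 + of_real r))))"
  proof
    assume fin: "finite (range (\<lambda>r :: real. exp (c * (t0 + of_real r))))"
    obtain c' where c': "c = of_real c'" using c(1) by (auto elim: Reals_cases)
    have "inj (\<lambda>r :: real. exp (c * (t0 + of_real r)))"
    proof (rule injI)
      fix r r' :: real assume "exp (c * (t0 + of_real r)) = exp (c * (t0 + of_real r'))"
      then have "norm (exp (c * (t0 + of_real r))) = norm (exp (c * (t0 + of_real r')))" by simp
      then show "r = r'" using c(2) by (simp add: c' norm_exp_eq_Re)
    qed
    then show False using fin finite_imageD infinite_UNIV_char_0 by blast
  qed
  then have "infinite {x. poly ?r x = 0}"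
    by (rule infinite_super[rotated]) (use root in auto)
  then have "?r = 0" using poly_roots_finite by blast
  then have pc: "coeff (pcompose p [:0, ?\<omega>:]) k = ?\<omega> ^ N * coeff p k" for k
    by (simp add: right_minus_eq)
  \<comment> \<open>\<omega>^k = \<omega>^N only for k = N. Hence p is a multiple of X^N, and
    dividing by X^N leaves a constant g.\<close>
  have "coeff p k = 0" if "k \<noteq> N" for k
  proof -
    have "?\<omega> ^ k * coeff p k = ?\<omega> ^ N * coeff p k"
      using pc[of k] by (simp add: coeff_pcompose_linear)
    moreover have "?\<omega> ^ k \<noteq> ?\<omega> ^ N"
    proof
      assume eq: "?\<omega> ^ k = ?\<omega> ^ N"
      have "?\<omega> ^ (max k N - min k N) = 1"
        using eq by (simp add: power_diff max_def min_def)
      then show False using generic that by (metis diff_is_0_eq max_def min_def nat_le_linear order_antisym)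
    qed
    ultimately show ?thesis by simp
  qed
  then have "p = monom (coeff p N) N" by (intro poly_eqI) auto
  then have "poly p (exp (c * t)) = coeff p N * exp (c * t) ^ N" for t
    by (metis poly_monom)
  then have "g t = coeff p N" for t using p[of t] by simp
  then show ?thesis by simp
qed

section \<open>Central elements as multiplication operators\<close>

lemma K_root_shifted:
  assumes i: "i \<in> {1..n}" and s: "\<And>k. k \<notin> {1..n} \<Longrightarrow> s k = 0"
  shows "K_root n b l i (shifted b s z)
      = K_root n b l i z * qpow b (of_int (s (i + 1) + s (i - 1) - 2 * s i) / real (n + 1))"
proof -
  have "zext n l (shifted b s z) k = zext n l z k + \<i> * of_real b * of_int (s k)" for k
    using s[of 0] s[of "n + 1"] by (simp add: zext_def shifted_def)
  then show ?thesis
    unfolding K_root_def qpow_def exp_add[symmetric]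
    by (intro arg_cong[where f = exp]) (simp add: algebra_simps add_divide_distrib diff_divide_distrib power2_eq_square)
qed

text \<open>Injectivity of the Cartan matrix: vanishing second differences make s linear, and a
  linear function vanishing at both ends is zero.\<close>

lemma discrete_harmonic_zero:
  fixes s :: "nat \<Rightarrow> int"
  assumes "s 0 = 0" "s (n + 1) = 0" and harmonic: "\<And>i. i \<in> {1..n} \<Longrightarrow> s (i + 1) + s (i - 1) - 2 * s i = 0"
    and k: "k \<le> n + 1"
  shows "s k = 0"
proof -
  have lin: "j \<le> n + 1 \<Longrightarrow> s j = int j * s 1" for j
  proof (induction j rule: less_induct)
    case (less j)
    consider "j = 0" | "j = 1" | i where "j = i + 1" "i \<in> {1..n}"
      using less.prems by (cases j) force+
    then show ?case
    proof cases
      case 3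
      have "s (i - 1) = int (i - 1) * s 1" "s i = int i * s 1"
        using 3 less.prems less.IH[of "i - 1"] less.IH[of i] by simp_all
      then show ?thesis using 3 harmonic[of i] by (simp add: of_nat_diff algebra_simps)
    qed (use assms in simp_all)
  qed
  have "s 1 = 0" using lin[of "n + 1"] assms(2) by simp
  then show ?thesis using lin[OF k] by simp
qed

text \<open>Commuting with \<open>Kr i\<close> forces \<open>K_root i\<close> to agree at both ends
  of any shift with nonzero coefficient. By genericity the Cartan matrix then annihilates the shift,
  so the shift is zero.\<close>

lemma center_multiplication_operator:
  assumes b: "0 < b" and generic: "\<And>m. qpow b (real m / real (n + 1)) = 1 \<Longrightarrow> m = 0"
    and x: "x \<in> uq_center n b"
  shows "rep (gen_op n b l) x \<phi> z = rep (gen_op n b l) x (\<lambda>z. 1) z * \<phi> z"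
proof -
  let ?D = "rep (gen_op n b l) x"
  have generic_int: "m = 0" if "qpow b (of_int m / real (n + 1)) = 1" for m :: int
  proof (cases "m \<ge> 0")
    case True
    then show ?thesis using that generic[of "nat m"] by (simp add: add.commute)
  next
    case False
    then have "of_int m / real (n + 1) = - (real (nat (- m)) / real (n + 1))" by simp
    then have "qpow b (real (nat (- m)) / real (n + 1)) = 1"
      using that by (simp only: qpow_minus inverse_eq_1_iff)
    then show ?thesis using generic[of "nat (- m)"] False by (simp add: add.commute)
  qed
  obtain S F where S: "finite S" "\<And>s k. s \<in> S \<Longrightarrow> k \<notin> {1..n} \<Longrightarrow> s k = 0"
    and D: "\<And>\<phi> z. ?D \<phi> z = (\<Sum>s\<in>S. F s z * \<phi> (shifted b s z))"
    using diff_op_normal_form[OF diff_op_rep[of n b l x]] by blast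
  have F0: "s = (\<lambda>k. 0)" if s: "s \<in> S" and Fs: "F s z \<noteq> 0" for s
  proof -
    let ?w = "shifted b s z"
    \<comment> \<open>Distinct shifts of z are distinct points, so this indicator function isolates
      the coefficient \<open>F s z\<close>; on it, multiplication by \<open>K_root\<close> is
      multiplication by a number.\<close>
    let ?\<delta> = "\<lambda>w. if w = ?w then 1 else 0 :: complex"
    have Dd: "?D ?\<delta> z = F s z"
    proof -
      have "?D ?\<delta> z = (\<Sum>t\<in>S. if t = s then F t z else 0)"
        unfolding D using b by (intro sum.cong) (auto simp: shifted_eq_iff)
      then show ?thesis using S(1) s by simp
    qed
    have "s (i + 1) + s (i - 1) - 2 * s i = 0" if i: "i \<in> {1..n}" for i
    proof -
      have "(\<lambda>w. K_root n b l i w * ?\<delta> w) = (\<lambda>w. K_root n b l i ?w * ?\<delta> w)" by auto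
      then have "K_root n b l i ?w * ?D ?\<delta> z = K_root n b l i z * ?D ?\<delta> z"
        using fun_cong[OF rep_center[OF uq_module_gen_op[of n b l] x, of "Kr i" ?\<delta>], of z]
        unfolding gen_op_Kr(1)[OF i] by (simp only: lin_op_scale[OF uq_moduleD(2)[OF uq_module_gen_op]])
      then have "K_root n b l i ?w = K_root n b l i z" using Fs unfolding Dd by simp
      moreover have "K_root n b l i ?w
          = K_root n b l i z * qpow b (of_int (s (i + 1) + s (i - 1) - 2 * s i) / real (n + 1))"
        by (rule K_root_shifted[OF i]) (rule S(2)[OF s])
      ultimately have "qpow b (of_int (s (i + 1) + s (i - 1) - 2 * s i) / real (n + 1)) = 1"
        using mult_cancel_left1[of "K_root n b l i z"] K_root_nonzero by metis
      then show ?thesis by (rule generic_int)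
    qed
    then have "s k = 0" for k
      using discrete_harmonic_zero[of s n k] S(2)[OF s] by (cases "k \<le> n + 1") auto
    then show ?thesis by auto
  qed
  have "F s z * \<phi> (shifted b s z) = F s z * 1 * \<phi> z" if "s \<in> S" for s
    using F0[OF that] by (cases "F s z = 0") (auto simp: shifted_def)
  then show ?thesis
    unfolding D sum_distrib_right by (intro sum.cong) auto
qed

text \<open>Commuting with \<open>e_i\<close> makes the multiplier f invariant under the shift of
  coordinate i wherever the coefficient of \<open>e_i\<close> is nonzero. A single line of such
  points suffices for \<open>periodic_exp_sum_const\<close>, so f is constant in each
  coordinate.\<close>

lemma center_scalar:
  assumes n: "n \<ge> 1" and b: "0 < b" and generic: "\<And>m. qpow b (real m / real (n + 1)) = 1 \<Longrightarrow> m = 0"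
    and x: "x \<in> uq_center n b"
  shows "\<exists>c. \<forall>\<phi>. rep (gen_op n b l) x \<phi> = (\<lambda>z. c * \<phi> z)"
proof -
  let ?D = "rep (gen_op n b l) x"
  define f where "f = ?D (\<lambda>z. 1)"
  have D: "?D \<phi> z = f z * \<phi> z" for \<phi> z
    unfolding f_def by (rule center_multiplication_operator[OF b generic x])
  have f: "exp_poly n b f"
    unfolding f_def by (rule diff_op_exp_poly[OF diff_op_rep])
  have shift: "f (shift i (\<i> * of_real b) z) = f z"
    if i: "i \<in> {1..n}" and r: "(ratio n b l i z)\<^sup>2 \<noteq> -1" for i z
  proof -
    let ?r = "ratio n b l i z"
    have "f z * ((?r + inverse ?r) * 1) = (?r + inverse ?r) * f (shift i (\<i> * of_real b) z)"
      using fun_cong[OF rep_center[OF uq_module_gen_op[of n b l] x, of "Eg i" "\<lambda>z. 1"], of z]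
      unfolding gen_op_Eg[OF i] D by simp
    moreover have "?r + inverse ?r \<noteq> 0"
    proof
      assume "?r + inverse ?r = 0"
      then have "?r * (?r + inverse ?r) = 0" by simp
      then have "?r\<^sup>2 + 1 = 0" by (simp add: distrib_left power2_eq_square)
      then show False using r by (simp add: add_eq_0_iff2)
    qed
    ultimately show ?thesis by simp
  qed
  have coord: "f (z(i := t)) = f (z(i := t'))" if i: "i \<in> {1..n}" for i z t t'
  proof -
    let ?c = "complex_of_real (pi * b / (n + 1))"
    obtain xs :: "(complex \<times> int) list"
      where xs: "\<And>t. f (z(i := t)) = (\<Sum>(\<alpha>, m)\<leftarrow>xs. \<alpha> * exp (?c * of_int m * t))"
      using exp_poly_coordinate[OF f i, of z] by blast
    \<comment> \<open>With this base point the coordinate difference in \<open>ratio i\<close> is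
      the real number r. Its square is then a positive multiple of q and could be -1 only if q = -1,
      which genericity excludes.\<close>
    let ?t0 = "zext n l z (i - 1)"
    have period: "f (z(i := ?t0 + of_real r + \<i> * of_real b)) = f (z(i := ?t0 + of_real r))" for r :: real
    proof -
      let ?z = "z(i := ?t0 + of_real r)"
      have "zext n l ?z i - zext n l ?z (i - 1) = of_real r"
        using i by (auto simp: zext_def)
      then have r: "ratio n b l i ?z = exp (of_real (pi * b * r) + \<i> * of_real (pi * b\<^sup>2 / 2))"
        unfolding ratio_def by simp
      have r2: "(ratio n b l i ?z)\<^sup>2 = exp (of_real (2 * pi * b * r)) * qpow b 1"
        unfolding r power2_eq_square[of "exp _"] qpow_def exp_add[symmetric]
        by (intro arg_cong[where f = exp]) (simp add: algebra_simps)
      have "(ratio n b l i ?z)\<^sup>2 \<noteq> -1"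
      proof
        assume eq: "(ratio n b l i ?z)\<^sup>2 = -1"
        then have "norm (exp (complex_of_real (2 * pi * b * r)) * qpow b 1) = 1"
          unfolding r2 by simp
        then have "exp (complex_of_real (2 * pi * b * r)) = 1"
          using b by (simp add: norm_mult norm_exp_eq_Re)
        then have "qpow b 1 = -1" using eq unfolding r2 by simp
        then have "qpow b (real (2 * (n + 1)) / real (n + 1)) = 1"
        proof -
          have "real (2 * (n + 1)) / real (n + 1) = real 2" by (simp add: field_simps)
          then show ?thesis using \<open>qpow b 1 = -1\<close> by (simp add: qpow_of_nat[of b 2, simplified] add.commute)
        qed
        then show False using generic[of "2 * (n + 1)"] by (simp add: add.commute)
      qed
      then have "f (shift i (\<i> * of_real b) ?z) = f ?z" by (rule shift[OF i])
      then show ?thesis by (simp add: shift_def)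
    qed
    have omega: "m = 0" if "exp (?c * (\<i> * of_real b)) ^ m = 1" for m
    proof (rule generic)
      have "exp (?c * (\<i> * of_real b)) ^ m = qpow b (real m / real (n + 1))"
        unfolding qpow_def exp_of_nat_mult[symmetric]
        by (intro arg_cong[where f = exp]) (simp add: power2_eq_square)
      then show "qpow b (real m / real (n + 1)) = 1" using that by simp
    qed
    show ?thesis
      unfolding xs
    proof (rule periodic_exp_sum_const[where c = ?c and ?t0.0 = ?t0 and d = "\<i> * of_real b"])
      show "?c \<noteq> 0" using b by (simp add: field_simps del: of_nat_Suc)
    qed (rule Reals_of_real period[unfolded xs] omega; assumption?)+
  qed
  have partial: "f z = f (\<lambda>k. if k \<in> {1..m} then 0 else z k)" if "m \<le> n" for z m
    using that
  proof (induction m)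
    case (Suc m)
    let ?y = "\<lambda>k. if k \<in> {1..m} then 0 else z k"
    have "f ?y = f (?y(Suc m := z (Suc m)))" by (rule arg_cong[where f = f]) auto
    also have "\<dots> = f (?y(Suc m := 0))" using Suc.prems by (intro coord) auto
    also have "?y(Suc m := 0) = (\<lambda>k. if k \<in> {1..Suc m} then 0 else z k)" by auto
    finally show ?case using Suc by simp
  qed simp
  have "f z = f (\<lambda>k. 0)" for z
    by (rule trans[OF partial[OF order_refl] exp_poly_cong[OF f]]) simp
  then show ?thesis using D by (intro exI[of _ "f (\<lambda>k. 0)"]) (simp add: fun_eq_iff)
qed

text \<open>The scalar from \<open>center_scalar\<close> is the same for all functions, so
  evaluating on \<open>top_vector\<close> identifies it.\<close>

lemma casimir_scalar:
  assumes n: "2 \<le> n" and b: "0 < b" and C: "casimirs n b C" and k: "k \<in> {1..n}"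
  shows "rep (gen_op n b l) (C k) \<phi> = (\<lambda>z. casimir_value n b (- of_real (tau n b l)) k * \<phi> z)"
proof -
  have "C k \<in> uq_center n b"
    using C k uq_subalgebra.base[of "C k" "C ` {1..n}" n b] unfolding casimirs_def by blast
  then obtain c where c: "\<And>\<phi>. rep (gen_op n b l) (C k) \<phi> = (\<lambda>z. c * \<phi> z)"
    using center_scalar[of n b "C k" l] casimirs_generic[OF n b C] n b by (auto simp: add.commute)
  have "c = casimir_value n b (- of_real (tau n b l)) k"
    using fun_cong[OF rep_casimir_top[OF b C k, of l], of "top_point b"]
    unfolding c by (simp add: top_vector_def)
  then show ?thesis using c by simp
qed

section \<open>Elementary symmetric functions\<close>

definition esym :: "('i \<Rightarrow> 'a::comm_ring_1) \<Rightarrow> 'i set \<Rightarrow> nat \<Rightarrow> 'a" where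
  "esym y A k = (\<Sum>S | S \<subseteq> A \<and> card S = k. \<Prod>j\<in>S. y j)"

lemma esym_0 [simp]:
  assumes "finite A" shows "esym y A 0 = 1"
proof -
  have "{S. S \<subseteq> A \<and> card S = 0} = {{}}" using assms by (auto dest: finite_subset)
  then show ?thesis by (simp add: esym_def)
qed

lemma esym_eq_0: "finite A \<Longrightarrow> card A < k \<Longrightarrow> esym y A k = 0"
proof -
  assume A: "finite A" "card A < k"
  have e: "{S. S \<subseteq> A \<and> card S = k} = {}" using A by (auto dest: card_mono)
  show "esym y A k = 0" unfolding esym_def e by (rule sum.empty)
qed

lemma esym_insert:
  assumes A: "finite A" "a \<notin> A"
  shows "esym y (insert a A) (Suc k) = esym y A (Suc k) + y a * esym y A k"
proof -
  let ?B = "\<lambda>k. {S. S \<subseteq> A \<and> card S = k}"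
  have fin: "finite (?B k)" for k by (rule finite_subset[of _ "Pow A"]) (use A in auto)
  have S: "finite S" "a \<notin> S" if "S \<in> ?B k" for S k using that A finite_subset[of S A] by auto
  have split: "{S. S \<subseteq> insert a A \<and> card S = Suc k} = ?B (Suc k) \<union> insert a ` ?B k" (is "?L = ?R")
  proof (intro set_eqI iffI)
    fix T assume T: "T \<in> ?L"
    then have "finite T" using A finite_subset[of T "insert a A"] by auto
    show "T \<in> ?R"
    proof (cases "a \<in> T")
      case True
      then have "T = insert a (T - {a})" "T - {a} \<in> ?B k" using T \<open>finite T\<close> by auto
      then show ?thesis by blast
    next
      case False
      then show ?thesis using T by auto
    qed
  next
    fix T assume "T \<in> ?R"
    then consider "T \<in> ?B (Suc k)" | U where "U \<in> ?B k" "T = insert a U" by blast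
    then show "T \<in> ?L"
    proof cases
      case 2
      then show ?thesis using S[OF 2(1)] by auto
    qed auto
  qed
  have disj: "?B (Suc k) \<inter> insert a ` ?B k = {}" using A by auto
  have inj: "inj_on (insert a) (?B k)"
  proof (rule inj_onI)
    fix T U assume h: "T \<in> ?B k" "U \<in> ?B k" "insert a T = insert a U"
    show "T = U" using insert_ident[OF S(2)[OF h(1)] S(2)[OF h(2)]] h(3) by (rule iffD1)
  qed
  have "esym y (insert a A) (Suc k) = esym y A (Suc k) + (\<Sum>S\<in>?B k. \<Prod>j\<in>insert a S. y j)"
    unfolding esym_def split sum.union_disjoint[OF fin finite_imageI[OF fin] disj] sum.reindex[OF inj] o_def ..
  also have "(\<Sum>S\<in>?B k. \<Prod>j\<in>insert a S. y j) = y a * esym y A k"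
    unfolding esym_def sum_distrib_left
  proof (rule sum.cong[OF refl])
    fix T assume T: "T \<in> ?B k"
    show "(\<Prod>j\<in>insert a T. y j) = y a * (\<Prod>j\<in>T. y j)"
      by (rule prod.insert[OF S[OF T]])
  qed
  finally show ?thesis .
qed

lemma prod_esym:
  "finite A \<Longrightarrow> (\<Prod>j\<in>A. x + y j) = (\<Sum>k\<le>card A. esym y A k * x ^ (card A - k))"
proof (induction A rule: finite_induct)
  case (insert a A)
  let ?N = "card A" and ?e = "esym y A"
  have "x * (\<Sum>k\<le>?N. ?e k * x ^ (?N - k)) = (\<Sum>k\<le>?N. ?e k * x ^ (Suc ?N - k))"
    unfolding sum_distrib_left by (rule sum.cong) (simp_all add: Suc_diff_le mult.left_commute)
  also have "\<dots> = (\<Sum>k\<le>Suc ?N. ?e k * x ^ (Suc ?N - k))"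
    using insert.hyps by (simp add: esym_eq_0)
  also have "\<dots> = x ^ Suc ?N + (\<Sum>k\<le>?N. ?e (Suc k) * x ^ (?N - k))"
    using insert.hyps by (subst sum.atMost_Suc_shift) simp
  finally have x: "x * (\<Sum>k\<le>?N. ?e k * x ^ (?N - k)) = x ^ Suc ?N + (\<Sum>k\<le>?N. ?e (Suc k) * x ^ (?N - k))" .
  have "(\<Prod>j\<in>insert a A. x + y j) = x * (\<Sum>k\<le>?N. ?e k * x ^ (?N - k)) + y a * (\<Sum>k\<le>?N. ?e k * x ^ (?N - k))"
    using insert by (simp add: distrib_right)
  also have "\<dots> = x ^ Suc ?N + (\<Sum>k\<le>?N. esym y (insert a A) (Suc k) * x ^ (?N - k))"
    unfolding x using insert.hyps
    by (simp add: esym_insert distrib_right sum.distrib sum_distrib_left mult.assoc)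
  also have "\<dots> = (\<Sum>k\<le>Suc ?N. esym y (insert a A) k * x ^ (Suc ?N - k))"
    using insert.hyps by (subst sum.atMost_Suc_shift) simp
  finally show ?case using insert.hyps by simp
qed simp

lemma esym_scale: "esym (\<lambda>j. c * y j) A k = c ^ k * esym y A k"
  unfolding esym_def sum_distrib_left by (rule sum.cong) (auto simp: prod.distrib)

lemma esym_cong: "(\<And>j. j \<in> A \<Longrightarrow> y j = y' j) \<Longrightarrow> esym y A k = esym y' A k"
  unfolding esym_def by (intro sum.cong prod.cong) auto

lemma of_real_esym: "complex_of_real (esym a A k) = esym (\<lambda>i. of_real (a i)) A k"
  by (simp add: esym_def)

lemma cnj_esym: "cnj (esym y A k) = esym (\<lambda>j. cnj (y j)) A k"
  by (simp add: esym_def)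

lemma esym_reindex:
  assumes "finite A" "inj_on f A"
  shows "esym y (f ` A) k = esym (\<lambda>j. y (f j)) A k"
  using assms
proof (induction A arbitrary: k rule: finite_induct)
  case (insert a A)
  then show ?case by (cases k) (simp_all add: esym_insert)
next
  case empty
  then show ?case by (cases k) (simp_all add: esym_eq_0)
qed

text \<open>The product over a subset is the product over \<open>A\<close> divided by that over the
  complement.\<close>

lemma esym_complement:
  fixes y :: "'i \<Rightarrow> 'a :: field"
  assumes "finite A" "k \<le> card A" "\<And>j. j \<in> A \<Longrightarrow> y j \<noteq> 0"
  shows "esym y A (card A - k) = (\<Prod>j\<in>A. y j) * esym (\<lambda>j. inverse (y j)) A k"
  using assms
proof (induction A arbitrary: k rule: finite_induct)
  case (insert a A)
  let ?N = "card A" and ?P = "\<Prod>j\<in>A. y j" and ?e = "esym y A" and ?f = "esym (\<lambda>j. inverse (y j)) A"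
  have IH: "?e (?N - k) = ?P * ?f k" if "k \<le> ?N" for k
    using insert that by auto
  have a: "y a \<noteq> 0" using insert.prems by simp
  show ?case
  proof (cases k)
    case 0
    then show ?thesis using IH[of 0] insert.hyps by (simp add: esym_insert esym_eq_0)
  next
    case (Suc m)
    show ?thesis
    proof (cases "m = ?N")
      case True
      then show ?thesis using IH[of ?N] insert.hyps a Suc by (simp add: esym_insert esym_eq_0 field_simps)
    next
      case False
      then have m: "m < ?N" using insert Suc by simp
      then have d: "card (insert a A) - k = Suc (?N - Suc m)" using insert.hyps Suc by simp
      have e: "?e (Suc (?N - Suc m)) = ?P * ?f m" using IH[of m] m by (simp add: Suc_diff_Suc)
      have "y a * inverse (y a) = 1" using a by simp
      then have "?P * ?f m + y a * (?P * ?f (Suc m)) = y a * ?P * (?f (Suc m) + inverse (y a) * ?f m)"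
        by (simp add: algebra_simps)
      then show ?thesis
        unfolding d esym_insert[OF insert.hyps] e using IH[of "Suc m"] m insert.hyps Suc
        by (simp add: esym_insert)
    qed
  qed
qed simp

lemma esym_1: "finite A \<Longrightarrow> esym y A 1 = (\<Sum>j\<in>A. y j)"
  by (induction A rule: finite_induct) (simp_all add: esym_insert esym_eq_0)

lemma esym_2: "finite A \<Longrightarrow> 2 * esym y A 2 = (\<Sum>j\<in>A. y j)\<^sup>2 - (\<Sum>j\<in>A. (y j)\<^sup>2)"
proof (induction A rule: finite_induct)
  case (insert a A)
  have "esym y (insert a A) 2 = esym y A 2 + y a * (\<Sum>j\<in>A. y j)"
    using esym_insert[OF insert.hyps, of y 1] esym_1[OF insert.hyps(1), of y] by (simp add: numeral_2_eq_2)
  then have "2 * esym y (insert a A) 2 = 2 * esym y A 2 + 2 * (y a * (\<Sum>j\<in>A. y j))"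
    by (simp only: distrib_left)
  then show ?case unfolding insert.IH using insert.hyps
    by (simp add: power2_eq_square algebra_simps)
qed (simp add: esym_eq_0)

section \<open>Position relative to the positive region\<close>

text \<open>Vieta's formulas with a = exp (L i); the product is the constant coefficient 1.\<close>

lemma positive_casimir_regionE:
  assumes "c \<in> positive_casimir_region n"
  obtains a :: "nat \<Rightarrow> real" where "\<And>i. a i > 0" "(\<Prod>i\<in>{0..n}. a i) = 1"
    "\<And>k. k \<in> {1..n} \<Longrightarrow> c k = esym a {0..n} k" "\<And>k. k \<in> {1..n} \<Longrightarrow> c k > 0"
proof -
  obtain L where pos: "\<forall>k\<in>{1..n}. 0 < c k"
    and L: "monom 1 (n + 1) + (\<Sum>k\<in>{1..n}. monom (c k) (n + 1 - k)) + 1 = (\<Prod>i\<in>{0..n}. [:exp (L i), 1:])"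
      (is "?P = _")
    using assms unfolding positive_casimir_region_def by blast
  let ?a = "\<lambda>i. exp (L i)"
  have "(\<Prod>i\<in>{0..n}. [:?a i, 1:]) = (\<Sum>k\<le>n+1. esym (\<lambda>i. [:?a i:]) {0..n} k * [:0, 1:] ^ (n + 1 - k))"
    using prod_esym[of "{0..n}" "[:0, 1:]" "\<lambda>i. [:?a i:]"] by simp
  also have "\<dots> = (\<Sum>k\<le>n+1. monom (esym ?a {0..n} k) (n + 1 - k))"
  proof (rule sum.cong[OF refl])
    fix k
    have "(\<Prod>i\<in>S. [:?a i:]) = [:\<Prod>i\<in>S. ?a i:]" for S
      by (induction S rule: infinite_finite_induct) (simp_all add: one_pCons)
    moreover have "(\<Sum>i\<in>I. [:f i:]) = [:\<Sum>i\<in>I. f i:]" for I and f :: "nat set \<Rightarrow> real"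
      by (induction I rule: infinite_finite_induct) simp_all
    ultimately have "esym (\<lambda>i. [:?a i:]) {0..n} k = [:esym ?a {0..n} k:]"
      by (simp add: esym_def)
    then show "esym (\<lambda>i. [:?a i:]) {0..n} k * [:0, 1:] ^ (n + 1 - k) = monom (esym ?a {0..n} k) (n + 1 - k)"
      by (simp add: monom_altdef)
  qed
  finally have R: "?P = (\<Sum>k\<le>n+1. monom (esym ?a {0..n} k) (n + 1 - k))" using L by simp
  have coeff: "coeff ?P (n + 1 - k) = esym ?a {0..n} k" if "k \<le> n + 1" for k
  proof -
    have "coeff ?P (n + 1 - k) = (\<Sum>j\<le>n+1. if n + 1 - j = n + 1 - k then esym ?a {0..n} j else 0)"
      unfolding R by (simp add: coeff_sum)
    also have "\<dots> = (\<Sum>j\<le>n+1. if j = k then esym ?a {0..n} j else 0)"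
      by (rule sum.cong) (use that in auto)
    finally show ?thesis using that by simp
  qed
  have "c k = esym ?a {0..n} k" if k: "k \<in> {1..n}" for k
  proof -
    have "coeff ?P (n + 1 - k) = (\<Sum>j\<in>{1..n}. if n + 1 - j = n + 1 - k then c j else 0)"
    proof -
      have "n + 1 \<noteq> n + 1 - k" "n + 1 - k \<noteq> 0" using k by auto
      then show ?thesis by (simp add: coeff_sum coeff_1)
    qed
    also have "\<dots> = (\<Sum>j\<in>{1..n}. if j = k then c j else 0)"
      by (rule sum.cong) (use k in auto)
    finally show ?thesis using coeff[of k] k by simp
  qed
  moreover have "(\<Prod>i\<in>{0..n}. ?a i) = 1"
  proof -
    have "coeff ?P 0 = 1" by (simp add: coeff_sum)
    then have "esym ?a {0..n} (n + 1) = 1" using coeff[of "n + 1"] by simp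
    then show ?thesis using esym_complement[of "{0..n}" 0 ?a] by simp
  qed
  ultimately show thesis using that[of ?a] pos by simp
qed

text \<open>AM-GM for product 1, by summing 1 + ln x \<le> x.\<close>

lemma sum_ge_card_of_prod_eq_1:
  fixes a :: "'i \<Rightarrow> real"
  assumes "finite A" "\<And>i. i \<in> A \<Longrightarrow> a i > 0" "(\<Prod>i\<in>A. a i) = 1"
  shows "real (card A) \<le> (\<Sum>i\<in>A. a i)"
proof -
  have "(\<Sum>i\<in>A. ln (a i)) = 0"
  proof -
    have "a i \<noteq> 0" if "i \<in> A" for i using assms(2)[OF that] by simp
    then show ?thesis using ln_prod[of A a] assms(1,3) by simp
  qed
  moreover have "(\<Sum>i\<in>A. 1 + ln (a i)) \<le> (\<Sum>i\<in>A. a i)"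
  proof (rule sum_mono)
    fix i assume "i \<in> A"
    then show "1 + ln (a i) \<le> a i" using ln_le_minus_one[OF assms(2), of i] by simp
  qed
  ultimately show ?thesis by (simp add: sum.distrib)
qed

text \<open>The first value is the sum of the a_i and, as their product is 1, the last is the sum of
  their inverses.\<close>

lemma positive_casimir_region_bounds:
  assumes "c \<in> positive_casimir_region n" and n: "n \<ge> 1"
  shows "c 1 \<ge> n + 1" "c n \<ge> n + 1"
proof -
  obtain a :: "nat \<Rightarrow> real" where a: "\<And>i. a i > 0" "(\<Prod>i\<in>{0..n}. a i) = 1"
    and c: "\<And>k. k \<in> {1..n} \<Longrightarrow> c k = esym a {0..n} k"
    using positive_casimir_regionE[OF assms(1)] by metis
  have "real (card {0..n}) \<le> (\<Sum>i\<in>{0..n}. a i)"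
    by (rule sum_ge_card_of_prod_eq_1) (use a in auto)
  then show "c 1 \<ge> n + 1" using c[of 1] n by (simp add: esym_1[simplified])
  have "real (card {0..n}) \<le> (\<Sum>i\<in>{0..n}. inverse (a i))"
    by (rule sum_ge_card_of_prod_eq_1) (use a in \<open>auto simp: prod_inversef[unfolded comp_def]\<close>)
  moreover have "esym a {0..n} n = (\<Sum>i\<in>{0..n}. inverse (a i))"
    using esym_complement[of "{0..n}" 1 a] a(1) a(2) less_imp_neq[OF a(1)]
    by (auto simp: esym_1[simplified])
  ultimately show "c n \<ge> n + 1" using c[of n] n by simp
qed

section \<open>Quantum binomial coefficients on the unit circle\<close>

definition qchar :: "nat \<Rightarrow> real \<Rightarrow> nat \<Rightarrow> complex" where
  "qchar n b j = qpow b (real n + 1 - 2 * real j)"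

lemma qpow_sum: "qpow b (\<Sum>j\<in>S. f j) = (\<Prod>j\<in>S. qpow b (f j))"
  by (induction S rule: infinite_finite_induct) (simp_all add: qpow_add)

lemma qbin_esym: "qbin n b k = esym (qchar n b) {1..n} k"
  unfolding qbin_def esym_def qchar_def qpow_sum ..

lemma prod_qchar: "(\<Prod>j\<in>{1..n}. qchar n b j) = 1"
proof -
  have "(\<Sum>j\<in>{1..n}. real j) = real n * (real n + 1) / 2"
    by (induction n) (auto simp: field_simps)
  then have "(\<Sum>j\<in>{1..n}. real n + 1 - 2 * real j) = 0"
    by (simp add: sum_subtractf sum_distrib_left[symmetric] del: of_nat_Suc)
  then show ?thesis
    unfolding qchar_def qpow_sum[symmetric] by simp
qed

text \<open>Reversing the index inverts \<open>qchar\<close>, and on the unit circle inversion is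
  conjugation.\<close>

lemma cnj_qbin: "cnj (qbin n b k) = qbin n b k"
proof -
  have "(\<lambda>j. n + 1 - j) ` {1..n} = {1..n}"
  proof (intro set_eqI iffI)
    fix j assume "j \<in> {1..n}"
    then show "j \<in> (\<lambda>j. n + 1 - j) ` {1..n}" by (intro image_eqI[of _ _ "n + 1 - j"]) auto
  qed auto
  then have "qbin n b k = esym (qchar n b) ((\<lambda>j. n + 1 - j) ` {1..n}) k"
    by (simp only: qbin_esym)
  also have "\<dots> = esym (\<lambda>j. qchar n b (n + 1 - j)) {1..n} k"
    by (rule esym_reindex) (auto simp: inj_on_def)
  also have "\<dots> = esym (\<lambda>j. cnj (qchar n b j)) {1..n} k"
    by (rule esym_cong) (auto simp: qchar_def cnj_qpow of_nat_diff intro!: arg_cong[where f = "qpow b"])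
  finally show ?thesis by (simp add: qbin_esym cnj_esym)
qed

lemma qbin_real: "qbin n b k = of_real (Re (qbin n b k))"
  using cnj_qbin[of n b k] by (simp add: complex_eq_iff)

lemma qbin_symmetric:
  assumes "k \<le> n"
  shows "qbin n b (n - k) = qbin n b k"
proof -
  have "qbin n b (n - k) = esym (\<lambda>j. inverse (qchar n b j)) {1..n} k"
  proof -
    have "esym (qchar n b) {1..n} (card {1..n} - k)
        = (\<Prod>j\<in>{1..n}. qchar n b j) * esym (\<lambda>j. inverse (qchar n b j)) {1..n} k"
      by (rule esym_complement) (use assms in \<open>simp_all add: qchar_def\<close>)
    then show ?thesis unfolding prod_qchar by (simp add: qbin_esym)
  qed
  also have "\<dots> = cnj (qbin n b k)"
    unfolding qbin_esym cnj_esym by (rule esym_cong) (simp only: qchar_def cnj_qpow qpow_minus)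
  finally show ?thesis by (simp only: cnj_qbin)
qed

lemma qbin_0 [simp]: "qbin n b 0 = 1"
  by (simp add: qbin_esym)

text \<open>In Newton's identity 2 e_2 = e_1^2 - p_2 the first term is the square of a real number,
  and p_2 is a sum of n numbers of modulus 1.\<close>

lemma Re_qbin_2: "2 * Re (qbin n b 2) \<ge> - real n"
proof -
  have r1: "qbin n b 1 = of_real (Re (qbin n b 1))" by (rule qbin_real)
  have "2 * qbin n b 2 = (qbin n b 1)\<^sup>2 - (\<Sum>j\<in>{1..n}. (qchar n b j)\<^sup>2)"
    unfolding qbin_esym by (simp only: esym_1[OF finite_atLeastAtMost] esym_2[OF finite_atLeastAtMost])
  then have "2 * Re (qbin n b 2) = Re ((qbin n b 1)\<^sup>2) - Re (\<Sum>j\<in>{1..n}. (qchar n b j)\<^sup>2)"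
    by (metis Re_divide_numeral minus_complex.sel(1) mult_2 plus_complex.sel(1))
  moreover have "Re ((qbin n b 1)\<^sup>2) = (Re (qbin n b 1))\<^sup>2"
    by (subst r1) (simp only: of_real_power[symmetric] Re_complex_of_real)
  moreover have "Re (\<Sum>j\<in>{1..n}. (qchar n b j)\<^sup>2) \<le> real n"
  proof -
    have "Re (\<Sum>j\<in>{1..n}. (qchar n b j)\<^sup>2) \<le> norm (\<Sum>j\<in>{1..n}. (qchar n b j)\<^sup>2)"
      by (rule complex_Re_le_cmod)
    also have "\<dots> \<le> (\<Sum>j\<in>{1..n}. norm ((qchar n b j)\<^sup>2))" by (rule norm_sum)
    also have "\<dots> = real n" by (simp add: qchar_def norm_power)
    finally show ?thesis .
  qed
  ultimately show ?thesis using zero_le_power2[of "Re (qbin n b 1)"] by linarith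
qed

section \<open>Real Casimir values and their exclusion from the region\<close>

definition casimir_real :: "nat \<Rightarrow> real \<Rightarrow> real \<Rightarrow> nat \<Rightarrow> real" where
  "casimir_real n b t k = (-1) ^ n *
     ((- t) ^ k * Re (qbin n b k) + Re (qbin n b (k - 1)) / (- t) ^ (n + 1 - k))"

lemma of_real_casimir_real:
  "complex_of_real (casimir_real n b t k) = casimir_value n b (- of_real t) k"
  by (simp add: casimir_real_def casimir_value_def qbin_real[symmetric])

text \<open>The two signs combine to (-1)^(nk), which amounts to multiplying each of the n + 1
  numbers behind \<open>casimir_value\<close> by (-1)^n.\<close>

lemma positive_normalization_esym:
  assumes t: "t > 0" and k: "k \<in> {1..n}"
  shows "complex_of_real (positive_normalization n (casimir_real n b t) k)
    = esym (\<lambda>j. if j = n + 1 then 1 / of_real t ^ n else of_real ((-1) ^ (n + 1) * t) * qchar n b j) {1..n+1} k"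
    (is "_ = esym ?w _ _")
proof -
  let ?s = "complex_of_real ((-1) ^ (n + 1) * t)"
  obtain m where m: "k = Suc m" "m < n" using k by (cases k) auto
  have set: "{1..n+1} = insert (n + 1) {1..n}" by auto
  have e: "esym ?w {1..n} i = ?s ^ i * qbin n b i" for i
    unfolding qbin_esym esym_scale[symmetric] by (rule esym_cong) auto
  have "esym ?w {1..n+1} k = ?s ^ k * qbin n b k + 1 / of_real t ^ n * (?s ^ m * qbin n b m)"
    unfolding set m(1) by (subst esym_insert) (simp_all only: e finite_atLeastAtMost if_P, auto)
  also have "\<dots> = (-1) ^ (n * (k + 1)) * casimir_value n b (- of_real t) k"
  proof -
    have s: "?s ^ i = ((-1) ^ (n + 1)) ^ i * of_real t ^ i" for i
      by (simp only: of_real_mult of_real_power of_real_minus of_real_1 power_mult_distrib)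
    have s1: "(-1) ^ (n * (k + 1)) * ((-1) ^ n * (- complex_of_real t) ^ k) = ?s ^ k"
    proof -
      have "(-1) ^ (n * (k + 1)) * (-1) ^ n * (-1) ^ k = (((-1) ^ (n + 1)) ^ k :: complex)"
        by (cases "even n"; cases "even k") (simp_all add: power_mult[symmetric])
      then show ?thesis
        by (simp only: s power_minus[of "complex_of_real t"] mult.assoc[symmetric])
    qed
    have s2: "(-1) ^ (n * (k + 1)) * ((-1) ^ n / (- complex_of_real t) ^ (n + 1 - k)) = 1 / of_real t ^ n * ?s ^ m"
    proof -
      have "(-1) ^ (n * (k + 1)) * ((-1) ^ n * (-1) ^ (n + 1 - k)) = (((-1) ^ (n + 1)) ^ m :: complex)"
        using m by (cases "even n"; cases "even m") (simp_all add: power_mult[symmetric])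
      moreover have "complex_of_real t ^ n = of_real t ^ m * of_real t ^ (n + 1 - k)"
        using m by (simp flip: power_add)
      moreover have "1 / (- complex_of_real t) ^ (n + 1 - k) = (-1) ^ (n + 1 - k) / of_real t ^ (n + 1 - k)"
        by (cases "even (n + 1 - k)") simp_all
      ultimately show ?thesis using t
        unfolding s by (simp add: divide_simps mult_ac)
    qed
    have "(-1) ^ (n * (k + 1)) * casimir_value n b (- of_real t) k
        = ((-1) ^ (n * (k + 1)) * ((-1) ^ n * (- complex_of_real t) ^ k)) * qbin n b k
          + ((-1) ^ (n * (k + 1)) * ((-1) ^ n / (- complex_of_real t) ^ (n + 1 - k))) * qbin n b m"
    proof -
      have alg: "A * (B * (P * Q + R / D)) = A * (B * P) * Q + A * (B / D) * R" for A B P Q R D :: complex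
        by (simp add: distrib_left mult_ac)
      show ?thesis unfolding casimir_value_def m(1) by (simp only: alg diff_Suc_1)
    qed
    then show ?thesis unfolding s1 s2 by (simp add: mult.assoc)
  qed
  finally show ?thesis
    by (simp add: positive_normalization_def of_real_casimir_real)
qed

text \<open>A positive number of modulus 1 is 1, and q^2 = 1 would make b^2 an integer strictly
  between 0 and 1.\<close>

lemma qpow_2_not_positive:
  assumes "0 < b" "b < 1" and "qpow b 2 = of_real r" "r > 0"
  shows False
proof -
  have "r = 1" using norm_qpow[of b 2] assms(3,4) by simp
  then have "qpow b 2 = 1" using assms(3) by simp
  then obtain m :: int where "pi * b\<^sup>2 * 2 = of_int (2 * m) * pi"
    unfolding qpow_def exp_eq_1 by auto
  then have "b\<^sup>2 = of_int m" by simp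
  moreover have "0 < b\<^sup>2" "b\<^sup>2 < 1" using assms by (simp_all add: power_less_one_iff abs_square_less_1)
  ultimately show False by simp
qed

text \<open>The roots of the polynomial of \<open>c\<close> include \<open>- w\<close> and \<open>- w'\<close> with
  \<open>w / w' = q\<^sup>2\<close>, so they are not both negative.\<close>

lemma positive_normalization_outside:
  assumes n: "2 \<le> n" and b: "0 < b" "b < 1" and t: "t > 0"
  shows "positive_normalization n (casimir_real n b t) \<notin> positive_casimir_region n"
proof
  let ?c = "positive_normalization n (casimir_real n b t)"
  let ?w = "\<lambda>j. if j = n + 1 then 1 / of_real t ^ n else of_real ((-1) ^ (n + 1) * t) * qchar n b j"
  assume "?c \<in> positive_casimir_region n"
  then obtain a :: "nat \<Rightarrow> real" where a: "\<And>i. a i > 0" "(\<Prod>i\<in>{0..n}. a i) = 1"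
    and c: "\<And>k. k \<in> {1..n} \<Longrightarrow> ?c k = esym a {0..n} k"
    using positive_casimir_regionE by metis
  have set: "{1..n+1} = insert (n + 1) {1..n}" by auto
  \<comment> \<open>The symmetric function of index n + 1 is not one of the Casimirs. It is supplied
    by both products being 1, so the full polynomials can be compared.\<close>
  have prod: "(\<Prod>j\<in>{1..n+1}. ?w j) = 1"
  proof -
    have "(\<Prod>j\<in>{1..n}. ?w j) = (\<Prod>j\<in>{1..n}. of_real ((-1) ^ (n + 1) * t) * qchar n b j)"
      by (rule prod.cong) auto
    also have "\<dots> = of_real ((-1) ^ (n + 1) * t) ^ n"
      by (simp only: prod.distrib prod_qchar) simp
    also have "\<dots> = of_real t ^ n"
      by (cases "even n") (simp_all add: power_mult_distrib)
    finally show ?thesis using t unfolding set by (subst prod.insert) auto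
  qed
  have e: "esym (\<lambda>i. complex_of_real (a i)) {0..n} k = esym ?w {1..n+1} k" if "k \<le> n + 1" for k
  proof -
    have "k = 0 \<or> k \<in> {1..n} \<or> k = n + 1" using that by auto
    then consider "k = 0" | "k \<in> {1..n}" | "k = n + 1" by blast
    then show ?thesis
    proof cases
      case 2
      then show ?thesis
        using positive_normalization_esym[OF t 2, of b] c[OF 2] by (simp only: of_real_esym)
    next
      case 3
      have "esym (\<lambda>i. complex_of_real (a i)) {0..n} (n + 1) = 1"
        using esym_complement[of "{0..n}" 0 a] a(2) less_imp_neq[OF a(1)]
        by (auto simp flip: of_real_esym)
      moreover have "esym ?w {1..n+1} (n + 1) = 1"
        using esym_complement[of "{1..n+1}" 0 ?w] prod t by (auto simp: qchar_def)
      ultimately show ?thesis using 3 by simp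
    qed simp
  qed
  have "(\<Prod>i\<in>{0..n}. x + complex_of_real (a i)) = (\<Prod>j\<in>{1..n+1}. x + ?w j)" for x
  proof -
    have card: "card {0..n} = n + 1" "card {1..n+1} = n + 1" by simp_all
    have "(\<Prod>i\<in>{0..n}. x + complex_of_real (a i))
        = (\<Sum>k\<le>n+1. esym (\<lambda>i. complex_of_real (a i)) {0..n} k * x ^ (n + 1 - k))"
      unfolding prod_esym[OF finite_atLeastAtMost] card ..
    also have "\<dots> = (\<Sum>k\<le>n+1. esym ?w {1..n+1} k * x ^ (n + 1 - k))"
      by (rule sum.cong) (simp_all only: e atMost_iff)
    also have "\<dots> = (\<Prod>j\<in>{1..n+1}. x + ?w j)"
      unfolding prod_esym[OF finite_atLeastAtMost] card ..
    finally show ?thesis .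
  qed
  \<comment> \<open>At x = - \<open>?w j\<close> the right-hand product vanishes, hence so does a
    factor on the left.\<close>
  then have "\<exists>i. ?w j = of_real (a i)" if "j \<in> {1..n+1}" for j
  proof -
    have "(\<Prod>i\<in>{0..n}. - ?w j + complex_of_real (a i)) = 0"
      unfolding \<open>\<And>x. (\<Prod>i\<in>{0..n}. x + complex_of_real (a i)) = (\<Prod>j\<in>{1..n+1}. x + ?w j)\<close>
      by (rule prod_zero) (use that in auto)
    then obtain i where "- ?w j + complex_of_real (a i) = 0" by (simp only: prod_zero_iff finite_atLeastAtMost) blast
    then have "complex_of_real (a i) = ?w j" by (simp only: add_eq_0_iff minus_minus)
    then show ?thesis by (intro exI) (rule sym)
  qed
  from this[of 1] this[of 2] obtain i i' where
    w1: "of_real ((-1) ^ (n + 1) * t) * qchar n b 1 = complex_of_real (a i)"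
    and w2: "of_real ((-1) ^ (n + 1) * t) * qchar n b 2 = complex_of_real (a i')"
    using n by auto
  have "qchar n b 1 = qpow b 2 * qchar n b 2"
    unfolding qchar_def qpow_add[symmetric] by (rule arg_cong[where f = "qpow b"]) simp
  then have "complex_of_real (a i) = qpow b 2 * of_real (a i')"
    unfolding w1[symmetric] w2[symmetric] by simp
  then have "qpow b 2 = of_real (a i / a i')"
    using a(1)[of i'] by (simp add: field_simps)
  then show False
    using qpow_2_not_positive[OF b] a(1) by (metis divide_pos_pos)
qed

text \<open>For odd \<open>n\<close> the sum of the roots and the sum of their inverses exclude each other: with
  \<open>g\<close> and \<open>h\<close> the first two quantum binomials, \<open>t * g \<ge> n\<close> or \<open>g / t \<ge> n\<close>, and
  then \<open>h \<ge> - n / 2\<close> makes one of the Casimirs with index \<open>2\<close> and \<open>n - 1\<close> negative.\<close>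

lemma casimir_real_outside_odd:
  assumes n: "2 \<le> n" "odd n" and t: "t > 0"
  shows "casimir_real n b t \<notin> positive_casimir_region n"
proof
  let ?c = "casimir_real n b t"
  assume R: "?c \<in> positive_casimir_region n"
  define g h where "g = Re (qbin n b 1)" and "h = Re (qbin n b 2)"
  have n3: "n \<ge> 3" using n by presburger
  have h: "2 * h \<ge> - real n" unfolding h_def by (rule Re_qbin_2)
  have bounds: "?c 1 \<ge> n + 1" "?c n \<ge> n + 1"
    using positive_casimir_region_bounds[OF R] n by auto
  have pos: "?c k > 0" if "k \<in> {1..n}" for k
    using R that by (auto simp: positive_casimir_region_def)
  have c1: "?c 1 = t * g + 1 / t ^ n"
    using n by (simp add: casimir_real_def g_def)
  have cn: "?c n = t ^ n + g / t"
    using n qbin_symmetric[of 1 n b] qbin_symmetric[of 0 n b] by (simp add: casimir_real_def g_def)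
  have even: "even (n - 1)" using n by simp
  have c2: "?c 2 = - (t\<^sup>2 * h + g / t ^ (n - 1))"
    using n n3 by (simp add: casimir_real_def g_def h_def)
  have cm: "?c (n - 1) = - (t ^ (n - 1) * g + h / t\<^sup>2)"
    using n n3 qbin_symmetric[of 1 n b] qbin_symmetric[of 2 n b]
    using power_minus_even[OF even, of t] by (simp add: casimir_real_def g_def h_def numeral_2_eq_2)
  show False
  \<comment> \<open>The case decides which of \<open>1 / t ^ n\<close> and \<open>t ^ n\<close> is
    at most 1, hence which of the two bounds leaves at least n for its term with g.\<close>
  proof (cases "t \<ge> 1")
    case True
    have tn: "t ^ n \<ge> 1" using True by simp
    then have "1 / t ^ n \<le> 1" by simp
    then have tg: "t * g \<ge> n" using bounds(1) c1 by linarith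
    have "t ^ n * (t * g) \<ge> 1 * real n"
      using tn tg by (intro mult_mono) auto
    then have "t ^ n * (t * g) + h > 0" using h n by linarith
    moreover have "t ^ n * (t * g) + h = (t ^ (n - 1) * g + h / t\<^sup>2) * t\<^sup>2"
    proof -
      have "t ^ n * t = t ^ (n - 1) * t\<^sup>2" using n by (simp flip: power_add power_Suc2)
      then show ?thesis using t by (simp add: field_simps)
    qed
    ultimately have "t ^ (n - 1) * g + h / t\<^sup>2 > 0"
      using t by (simp add: zero_less_mult_iff)
    moreover have "n - 1 \<in> {1..n}" using n3 by auto
    ultimately show False using pos[of "n - 1"] cm by simp
  next
    case False
    then have tn: "t ^ n \<le> 1" "t ^ n > 0" using t by (simp_all add: power_le_one)
    have tg: "g / t \<ge> n" using bounds(2) cn tn by linarith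
    have "1 / t ^ n * (g / t) \<ge> 1 * real n"
      using tn tg by (intro mult_mono) auto
    then have "1 / t ^ n * (g / t) + h > 0" using h n by linarith
    moreover have "t\<^sup>2 * (1 / t ^ n * (g / t) + h) = t\<^sup>2 * h + g / t ^ (n - 1)"
    proof -
      have "t ^ n * t = t ^ (n - 1) * t\<^sup>2" using n by (simp flip: power_add power_Suc2)
      then show ?thesis using t by (simp add: field_simps)
    qed
    ultimately have "t\<^sup>2 * h + g / t ^ (n - 1) > 0"
      using t by (metis zero_less_mult_iff zero_less_power)
    then show False using pos[of 2] c2 n by simp
  qed
qed

theorem theorem4p8:
  fixes n :: nat and b :: real and C :: "nat \<Rightarrow> uq_free"
  assumes "2 \<le> n" and "0 < b" and "b < 1"
    and "casimirs n b C"
  shows "\<forall>l :: real. \<exists>c :: nat \<Rightarrow> real.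
    (\<forall>k\<in>{1..n}. \<forall>\<phi>\<in>rep_core n.
        minimal_rep n b l (C k) \<phi> = (\<lambda>z. complex_of_real (c k) * \<phi> z)) \<and>
    c \<notin> positive_casimir_region n \<and>
    positive_normalization n c \<notin> positive_casimir_region n"
proof
  fix l
  let ?c = "casimir_real n b (tau n b l)"
  have t: "tau n b l > 0" by (simp add: tau_def)
  have norm: "positive_normalization n ?c \<notin> positive_casimir_region n"
    by (rule positive_normalization_outside[OF assms(1-3) t])
  have "?c \<notin> positive_casimir_region n"
  \<comment> \<open>For even n the exponent n (k + 1) is even, so both normalizations
    coincide.\<close>
  proof (cases "even n")
    case True
    then have "positive_normalization n ?c = ?c"
      by (simp add: positive_normalization_def fun_eq_iff)
    then show ?thesis using norm by simp
  qed (use casimir_real_outside_odd assms(1) t in blast)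
  moreover have "minimal_rep n b l (C k) \<phi> = (\<lambda>z. complex_of_real (?c k) * \<phi> z)" if "k \<in> {1..n}" for k \<phi>
    unfolding minimal_rep_eq of_real_casimir_real by (rule casimir_scalar[OF assms(1,2,4) that])
  ultimately show "\<exists>c :: nat \<Rightarrow> real.
    (\<forall>k\<in>{1..n}. \<forall>\<phi>\<in>rep_core n.
        minimal_rep n b l (C k) \<phi> = (\<lambda>z. complex_of_real (c k) * \<phi> z)) \<and>
    c \<notin> positive_casimir_region n \<and>
    positive_normalization n c \<notin> positive_casimir_region n"
    using norm by blast
qed

end
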